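(* Let $\nu\ge1$ and $p\ge1$ be integers, let $\omega\in\mathbb{R}^\nu$ have entries linearly independent over $\mathbb{Z}$, and let $k>0$. The generalized Benjamin–Bona–Mahony equation $$\partial_tu-\partial_{xxt}u+\partial_xu+\partial_x(u^{p+1})=0,\qquad u(0,x)=u_0(x),$$ understood as the ODE $$\partial_tu=\frac{-\partial_x}{1-\partial_x^2}\big(u+u^{p+1}\big)$$ for a $V^{\omega,k}_{\mathbb{R}}$-valued function of $t$, is unconditionally locally well-posed in $V^{\omega,k}_{\mathbb{R}}$ both forward and backward in time. That is: for every $u_0\in V^{\omega,k}_{\mathbb{R}}$ there exist an open ball $B\subseteq V^{\omega,k}_{\mathbb{R}}$ containing $u_0$ and a $T>0$ such that for every $\tilde u_0\in B$ there exists a unique solution $u:[-T,T]\to V^{\omega,k}_{\mathbb{R}}$ of this ODE with $u(0)=\tilde u_0$, and the data-to-solution map $B\to C([-T,T],V^{\omega,k}_{\mathbb{R}})$ is Lipschitz continuous.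
   Context: $|\cdot|$ on $\mathbb{Z}^\nu$ is the Euclidean norm. $V^{\omega,k}$ is the space of functions $u:\mathbb{R}\to\mathbb{C}$ of the form $u(x)=\sum_{n\in\mathbb{Z}^\nu}\widehat u(n)e^{i\langle\omega,n\rangle x}$ with finite norm $\|u\|_{\omega,k}=\sum_{n\in\mathbb{Z}^\nu}|\widehat u(n)|e^{k|n|}$; the coefficients are uniquely determined by $u$. $V^{\omega,k}_{\mathbb{R}}$ is the subspace of real-valued functions. $C([-T,T],V^{\omega,k}_{\mathbb{R}})$ is the space of continuous functions $[-T,T]\to V^{\omega,k}_{\mathbb{R}}$ with norm $\sup_{t\in[-T,T]}\|u(t)\|_{\omega,k}$. $\frac{-\partial_x}{1-\partial_x^2}$ is the Fourier multiplier operator with symbol $\frac{-i\xi}{1+\xi^2}$, i.e. it multiplies $\widehat u(n)$ by $\frac{-i\langle\omega,n\rangle}{1+\langle\omega,n\rangle^2}$. A solution on $[-T,T]$ is a continuously differentiable function $u:[-T,T]\to V^{\omega,k}_{\mathbb{R}}$ satisfying the ODE at every $t\in[-T,T]$. *)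

theory Defs
  imports "HOL-Analysis.Analysis"
begin

text \<open>Elements of \<open>\<int>\<^sup>\<nu>\<close> are vectors of type \<open>int ^ 'n\<close>, with \<open>\<nu> = CARD('n)\<close>.
  Both the pairing with \<open>\<omega>\<close> and the Euclidean norm go through the embedding into \<open>real ^ 'n\<close>.\<close>

definition real_vec :: "int ^ 'n \<Rightarrow> real ^ 'n" where
  "real_vec n = (\<chi> i. of_int (n $ i))"

definition freq :: "real ^ 'n \<Rightarrow> int ^ 'n \<Rightarrow> real" where
  "freq \<omega> n = \<omega> \<bullet> real_vec n"

definition Z_independent :: "real ^ 'n \<Rightarrow> bool" where
  "Z_independent \<omega> \<longleftrightarrow> (\<forall>n :: int ^ 'n. (\<Sum>i\<in>UNIV. of_int (n $ i) * \<omega> $ i) = 0 \<longrightarrow> n = 0)"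

definition weight :: "real \<Rightarrow> int ^ 'n \<Rightarrow> real" where
  "weight k n = exp (k * norm (real_vec n))"

definition fourier_series :: "real ^ 'n \<Rightarrow> (int ^ 'n \<Rightarrow> complex) \<Rightarrow> real \<Rightarrow> complex" where
  "fourier_series \<omega> a = (\<lambda>x. \<Sum>\<^sub>\<infinity>n. a n * exp (\<i> * of_real (freq \<omega> n * x)))"

text \<open>\<open>has_coeffs \<omega> k u a\<close>: the function \<open>u\<close> belongs to \<open>V\<^bsup>\<omega>,k\<^esup>\<close>, with Fourier coefficients \<open>a\<close>.
  For \<open>k \<ge> 0\<close> the weighted summability implies absolute convergence of the series.\<close>

definition has_coeffs ::
  "real ^ 'n \<Rightarrow> real \<Rightarrow> (real \<Rightarrow> complex) \<Rightarrow> (int ^ 'n \<Rightarrow> complex) \<Rightarrow> bool" where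
  "has_coeffs \<omega> k u a \<longleftrightarrow>
     (\<lambda>n. cmod (a n) * weight k n) summable_on UNIV \<and> u = fourier_series \<omega> a"

definition V_space :: "real ^ 'n \<Rightarrow> real \<Rightarrow> (real \<Rightarrow> complex) set" where
  "V_space \<omega> k = {u. \<exists>a. has_coeffs \<omega> k u a}"

text \<open>If the entries of \<open>\<omega>\<close> are independent over \<open>\<int>\<close> and \<open>k \<ge> 0\<close>, then the coefficients of
  every \<open>u \<in> V_space \<omega> k\<close> are unique, so the description operator below is meaningful.\<close>

definition V_coeff :: "real ^ 'n \<Rightarrow> real \<Rightarrow> (real \<Rightarrow> complex) \<Rightarrow> int ^ 'n \<Rightarrow> complex" where
  "V_coeff \<omega> k u = (THE a. has_coeffs \<omega> k u a)"

definition V_norm :: "real ^ 'n \<Rightarrow> real \<Rightarrow> (real \<Rightarrow> complex) \<Rightarrow> real" where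
  "V_norm \<omega> k u = (\<Sum>\<^sub>\<infinity>n. cmod (V_coeff \<omega> k u n) * weight k n)"

definition VR_space :: "real ^ 'n \<Rightarrow> real \<Rightarrow> (real \<Rightarrow> complex) set" where
  "VR_space \<omega> k = {u \<in> V_space \<omega> k. \<forall>x. u x \<in> \<real>}"

text \<open>The space \<open>V\<^bsup>\<omega>,k\<^esup>\<close> depends on the terms \<open>\<omega>\<close> and \<open>k\<close>, so it cannot be an instance of the
  normed-space type classes; its real part is treated as an abstract metric space instead.
  Under the hypotheses above (independence and \<open>k \<ge> 0\<close>) the pair is a \<open>Metric_space\<close>: outside
  the carrier, \<open>V_coeff\<close> of a function not in \<open>V_space \<omega> k\<close> is one fixed unspecified family, so
  the distance is symmetric and nonnegative everywhere, as the locale demands.\<close>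

definition VR_metric :: "real ^ 'n \<Rightarrow> real \<Rightarrow> (real \<Rightarrow> complex) metric" where
  "VR_metric \<omega> k = metric (VR_space \<omega> k, \<lambda>u v. V_norm \<omega> k (\<lambda>x. u x - v x))"

definition fourier_multiplier ::
  "real ^ 'n \<Rightarrow> real \<Rightarrow> (real \<Rightarrow> complex) \<Rightarrow> (real \<Rightarrow> complex) \<Rightarrow> (real \<Rightarrow> complex)" where
  "fourier_multiplier \<omega> k \<sigma> u = fourier_series \<omega> (\<lambda>n. \<sigma> (freq \<omega> n) * V_coeff \<omega> k u n)"

text \<open>The symbol of \<open>-\<partial>\<^sub>x / (1 - \<partial>\<^sub>x\<^sup>2)\<close>.\<close>

definition bbm_symbol :: "real \<Rightarrow> complex" where
  "bbm_symbol \<xi> = - \<i> * of_real \<xi> / (1 + (of_real \<xi>)\<^sup>2)"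

text \<open>Differentiability of \<open>u\<close> at \<open>t\<close> relative to \<open>S\<close>: convergence of the difference quotients
  in the norm of \<open>VR_space \<omega> k\<close>.\<close>

definition has_VR_derivative ::
  "real ^ 'n \<Rightarrow> real \<Rightarrow> (real \<Rightarrow> real \<Rightarrow> complex) \<Rightarrow> (real \<Rightarrow> complex) \<Rightarrow> real \<Rightarrow> real set \<Rightarrow> bool" where
  "has_VR_derivative \<omega> k u v t S \<longleftrightarrow>
     limitin (mtopology_of (VR_metric \<omega> k))
       (\<lambda>s x. (u s x - u t x) / of_real (s - t)) v (at t within S)"

text \<open>The functions are extensional on \<open>{-T..T}\<close>, so that equality of two solutions means equality
  on this interval, as in the function spaces of the library.\<close>

definition gbbm_solution ::
  "real ^ 'n \<Rightarrow> real \<Rightarrow> nat \<Rightarrow> real \<Rightarrow> (real \<Rightarrow> complex) \<Rightarrow> (real \<Rightarrow> real \<Rightarrow> complex) \<Rightarrow> bool" where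
  "gbbm_solution \<omega> k p T f u \<longleftrightarrow>
     u \<in> {-T..T} \<rightarrow>\<^sub>E VR_space \<omega> k \<and>
     u 0 = f \<and>
     (\<exists>u'. continuous_map (top_of_set {-T..T}) (mtopology_of (VR_metric \<omega> k)) u' \<and>
           (\<forall>t\<in>{-T..T}.
              has_VR_derivative \<omega> k u (u' t) t {-T..T} \<and>
              u' t = fourier_multiplier \<omega> k bbm_symbol (\<lambda>x. u t x + u t x ^ (p + 1))))"

definition gbbm_flow ::
  "real ^ 'n \<Rightarrow> real \<Rightarrow> nat \<Rightarrow> real \<Rightarrow> (real \<Rightarrow> complex) \<Rightarrow> (real \<Rightarrow> real \<Rightarrow> complex)" where
  "gbbm_flow \<omega> k p T f = (THE u. gbbm_solution \<omega> k p T f u)"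

end

(* Multiplying the n-th Fourier coefficient by the weight e^(k|n|) identifies the real part of the
   space V with the real Banach space of Hermitian summable families on Z^nu. The identification is
   well defined because the coefficients are determined by the function: finitely many of them can be
   removed by averaging over translates without enlarging the others. By submultiplicativity of
   the weight, pointwise multiplication becomes a bounded bilinear map, and the symbol
   -i xi / (1 + xi^2) is bounded. Hence the equation is an ODE with a locally Lipschitz vector
   field in a Banach space; existence and Lipschitz dependence come from the contraction principle
   on a short time interval, and unconditional uniqueness from a Gronwall argument. *)

theory Submission
  imports Defs
begin

section \<open>Ordinary differential equations with locally Lipschitz right-hand side\<close>

text \<open>The function space depends on the terms \<open>\<omega>\<close> and \<open>k\<close>,
  while derivatives, integrals and completeness are used here as properties of a type.
  \<open>herm_l1\<close> is such a type: once the weight is absorbed into the coefficients, neither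
  parameter is left in the linear structure or the norm. The analysis is done there, and an isometry
  carries the results back to the abstract metric space. The field is asked to be Lipschitz on every
  ball about 0, not merely near each point, because bounded sets of a Banach space need not be
  relatively compact. This gives one constant for two trajectories over a compact interval, and it
  is inherited by bounded bilinear products. Unconditional uniqueness also concerns solutions that
  might leave the ball in which the fixed point argument works. It is therefore proved without any
  smallness of time or data. It then identifies every solution with nearby initial value with the
  constructed one, so that it stays in the ball where the Lipschitz estimate is available.\<close>

definition locally_lipschitz :: "('a::real_normed_vector \<Rightarrow> 'a) \<Rightarrow> bool" where
  "locally_lipschitz G \<longleftrightarrow> (\<forall>R. \<exists>L. L-lipschitz_on (cball 0 R) G)"

definition solves_ode_on :: "('a::real_normed_vector \<Rightarrow> 'a) \<Rightarrow> real set \<Rightarrow> (real \<Rightarrow> 'a) \<Rightarrow> bool" where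
  "solves_ode_on G S u \<longleftrightarrow> (\<forall>t\<in>S. (u has_vector_derivative G (u t)) (at t within S))"

lemma solves_ode_on_continuous: "solves_ode_on G S u \<Longrightarrow> continuous_on S u"
  unfolding solves_ode_on_def by (rule continuous_on_vector_derivative[where f' = "\<lambda>t. G (u t)"]) simp

lemma solves_ode_on_subset: "solves_ode_on G S u \<Longrightarrow> R \<subseteq> S \<Longrightarrow> solves_ode_on G R u"
  unfolding solves_ode_on_def by (meson has_vector_derivative_within_subset subsetD)

text \<open>Time reversal reduces the past of a solution to the future of a solution for
  \<open>- G\<close>, which is Lipschitz with the same constants.\<close>

lemma solves_ode_on_reflect:
  assumes "solves_ode_on G S u"
  shows "solves_ode_on (\<lambda>x. - G x) (uminus ` S) (\<lambda>t. u (- t))"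
  unfolding solves_ode_on_def
proof
  fix t assume t: "t \<in> uminus ` S"
  have "(uminus has_vector_derivative -1) (at t within uminus ` S)"
    by (auto intro!: derivative_eq_intros)
  moreover have "(u has_vector_derivative G (u (-t))) (at (-t) within uminus ` uminus ` S)"
    using assms t unfolding solves_ode_on_def by (auto simp: image_image)
  ultimately have "(u \<circ> uminus has_vector_derivative (-1) *\<^sub>R G (u (-t))) (at t within uminus ` S)"
    by (rule vector_diff_chain_within)
  then show "((\<lambda>t. u (- t)) has_vector_derivative - G (u (- t))) (at t within uminus ` S)"
    by (simp add: o_def)
qed

text \<open>A Gronwall argument by a weighted maximum. Let \<open>D\<close> be the maximum of
  \<open>exp (- 2 * L * s) * norm (h s)\<close>, attained at \<open>t0\<close>. Since the
  exponential rate is twice the Lipschitz constant, integrating the bound on the derivative of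
  \<open>h\<close> recovers only half of \<open>norm (h t0)\<close>, which forces
  \<open>D = 0\<close>.\<close>

lemma ode_unique_forward:
  fixes u v :: "real \<Rightarrow> 'a::real_normed_vector"
  assumes G: "locally_lipschitz G"
    and u: "solves_ode_on G {0..T} u" and v: "solves_ode_on G {0..T} v"
    and init: "u 0 = v 0" and t: "t \<in> {0..T}"
  shows "u t = v t"
proof -
  note cont = solves_ode_on_continuous[OF u] solves_ode_on_continuous[OF v]
  \<comment> \<open>Both trajectories are compact, so a single ball contains them and a single
    Lipschitz constant serves on the whole interval.\<close>
  have "bounded (u ` {0..T} \<union> v ` {0..T})"
    using cont by (simp add: compact_continuous_image compact_imp_bounded)
  then obtain R where R: "\<And>x. x \<in> u ` {0..T} \<union> v ` {0..T} \<Longrightarrow> norm x \<le> R"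
    unfolding bounded_iff by blast
  obtain L0 where "L0-lipschitz_on (cball 0 R) G"
    using G unfolding locally_lipschitz_def by blast
  then obtain L where L: "L-lipschitz_on (cball 0 R) G" and "L > 0"
    using lipschitz_on_le[of L0 "cball 0 R" G "\<bar>L0\<bar> + 1"] by force
  define h where "h = (\<lambda>s. u s - v s)"
  have hc: "continuous_on {0..T} h"
    unfolding h_def by (intro continuous_intros cont)
  have "continuous_on {0..T} (\<lambda>s. exp (- 2 * L * s) * norm (h s))"
    by (intro continuous_intros hc)
  then obtain t0 where t0: "t0 \<in> {0..T}"
    and max: "\<And>s. s \<in> {0..T} \<Longrightarrow> exp (- 2 * L * s) * norm (h s) \<le> exp (- 2 * L * t0) * norm (h t0)"
    using continuous_attains_sup[of "{0..T}" "\<lambda>s. exp (- 2 * L * s) * norm (h s)"] t by force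
  define D where "D = exp (- 2 * L * t0) * norm (h t0)"
  have D: "norm (h s) \<le> D * exp (2 * L * s)" if "s \<in> {0..T}" for s
    using mult_right_mono[OF max[OF that], of "exp (2 * L * s)"]
    by (simp add: D_def mult.commute mult.left_commute flip: exp_add)
  have ht0: "norm (h t0) = D * exp (2 * L * t0)"
    by (simp add: D_def mult.commute mult.left_commute flip: exp_add)
  have D0: "D \<ge> 0" by (simp add: D_def)
  have "D = 0"
  proof (cases "t0 = 0")
    case True
    then show ?thesis using init by (simp add: D_def h_def)
  next
    case False
    then have "0 < t0" using t0 by simp
    \<comment> \<open>The derivative of \<open>h\<close> is dominated by
      \<open>L * (D * exp (2 * L * s))\<close>, whose primitive
      \<open>D * exp (2 * L * s) / 2\<close> is at \<open>t0\<close> half of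
      \<open>norm (h t0)\<close>.\<close>
    have "norm (h t0 - h 0) \<le> D * exp (2 * L * t0) / 2 - D * exp (2 * L * 0) / 2"
    proof (rule differentiable_bound_general[OF \<open>0 < t0\<close>])
      show "continuous_on {0..t0} h"
        using hc t0 by (auto intro: continuous_on_subset)
      show "continuous_on {0..t0} (\<lambda>s. D * exp (2 * L * s) / 2)"
        by (intro continuous_intros) auto
      show "(h has_vector_derivative G (u s) - G (v s)) (at s)" if "0 < s" "s < t0" for s
      proof -
        have "s \<in> interior {0..T}" using that t0 by simp
        then have "at s within {0..T} = at s" by (rule at_within_interior)
        then show ?thesis using u v that t0 unfolding solves_ode_on_def h_def
          by (intro has_vector_derivative_diff) (metis atLeastAtMost_iff less_eq_real_def less_le_trans)+
      qed
      show "((\<lambda>s. D * exp (2 * L * s) / 2) has_vector_derivative L * (D * exp (2 * L * s))) (at s)" for s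
        by (rule has_real_derivative_iff_has_vector_derivative[THEN iffD1])
           (auto intro!: derivative_eq_intros)
      show "norm (G (u s) - G (v s)) \<le> L * (D * exp (2 * L * s))" if "0 < s" "s < t0" for s
      proof -
        have s: "s \<in> {0..T}" using that t0 by simp
        then have "norm (G (u s) - G (v s)) \<le> L * norm (h s)"
          using lipschitz_onD[OF L, of "u s" "v s"] R by (simp add: dist_norm h_def)
        also have "\<dots> \<le> L * (D * exp (2 * L * s))"
          using D[OF s] \<open>L > 0\<close> by simp
        finally show ?thesis .
      qed
    qed
    then have "D * exp (2 * L * t0) \<le> D * exp (2 * L * t0) / 2 - D / 2"
      using ht0 init by (simp add: h_def)
    moreover have "0 \<le> D * exp (2 * L * t0)" using D0 by simp
    ultimately show ?thesis using D0 by linarith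
  qed
  then show ?thesis using D[OF t] by (simp add: h_def)
qed

lemma ode_unique:
  fixes u v :: "real \<Rightarrow> 'a::real_normed_vector"
  assumes G: "locally_lipschitz G"
    and u: "solves_ode_on G {-T..T} u" and v: "solves_ode_on G {-T..T} v"
    and init: "u 0 = v 0" and t: "t \<in> {-T..T}"
  shows "u t = v t"
proof (cases "t \<ge> 0")
  case True
  moreover have "{0..T} \<subseteq> {-T..T}" using t by auto
  ultimately show ?thesis
    using ode_unique_forward[OF G solves_ode_on_subset[OF u] solves_ode_on_subset[OF v] init, of T t] t
    by simp
next
  case False
  have sub: "{0..T} \<subseteq> uminus ` {-T..T}" using t by auto
  have G': "locally_lipschitz (\<lambda>x. - G x)"
    using G unfolding locally_lipschitz_def by (simp add: lipschitz_on_def dist_norm norm_minus_commute)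
  have "u (- (- t)) = v (- (- t))"
    using ode_unique_forward[OF G' solves_ode_on_subset[OF solves_ode_on_reflect[OF u] sub]
        solves_ode_on_subset[OF solves_ode_on_reflect[OF v] sub], of "- t"] init t False
    by simp
  then show ?thesis by simp
qed

text \<open>The mean value inequality: the derivative, as the linear map
  \<open>x *\<^sub>R f' t\<close> in \<open>x\<close>, has operator norm at most
  \<open>norm (f' t)\<close>. The two points come in either order and the derivatives are relative
  to \<open>S\<close>, so both time directions and the endpoints are treated at once.\<close>

lemma vector_derivative_increment_bound:
  fixes f :: "real \<Rightarrow> 'a::real_normed_vector"
  assumes "convex S" and "\<And>t. t \<in> S \<Longrightarrow> (f has_vector_derivative f' t) (at t within S)"
    and "\<And>t. t \<in> S \<Longrightarrow> norm (f' t) \<le> C" and "s \<in> S" and "t \<in> S"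
  shows "norm (f s - f t) \<le> C * \<bar>s - t\<bar>"
proof -
  have "onorm (\<lambda>x. x *\<^sub>R f' t) \<le> C" if "t \<in> S" for t
    using assms(3)[OF that] by (auto intro!: onorm_le simp: mult.commute[of C] mult_left_mono)
  then show ?thesis
    using differentiable_bound[OF assms(1), of f "\<lambda>t x. x *\<^sub>R f' t" C s t] assms(2,4,5)
    by (simp add: has_vector_derivative_def)
qed

text \<open>Banach's fixed point theorem for the integral equation. A start within 1/2 of
  \<open>x0\<close> and a displacement of at most \<open>T * M \<le> 1 / 2\<close> keep the iterates
  in the closed unit ball about \<open>x0\<close>; \<open>T * L \<le> 1 / 2\<close> gives the
  contraction factor 1/2.\<close>

lemma ode_solution_exists:
  fixes G :: "'a::banach \<Rightarrow> 'a"
  assumes L: "L-lipschitz_on (cball x0 1) G" and M: "\<And>x. x \<in> cball x0 1 \<Longrightarrow> norm (G x) \<le> M"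
    and T: "T > 0" "T * M \<le> 1 / 2" "T * L \<le> 1 / 2" and f: "f \<in> ball x0 (1 / 2)"
  shows "\<exists>u. solves_ode_on G {-T..T} u \<and> u 0 = f \<and> (\<forall>t\<in>{-T..T}. u t \<in> cball x0 1)"
proof -
  \<comment> \<open>The integral starts at the left endpoint, and \<open>J\<close> subtracts its
    value at 0; one formula then represents the integral from 0 to \<open>t\<close> for either sign
    of \<open>t\<close>.\<close>
  define I where "I = (\<lambda>w t. integral {-T..t} (\<lambda>s. G (w s)))"
  define J where "J = (\<lambda>w t. f + (I w t - I w 0))"
  \<comment> \<open>The complete space at hand consists of bounded continuous functions on the whole
    line. Clamping the time to \<open>{-T..T}\<close> extends \<open>J w\<close> to such a
    function.\<close>
  define pr where "pr = (\<lambda>t. max (-T) (min T t))"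
  define S where "S = {w :: real \<Rightarrow>\<^sub>C 'a. \<forall>t. apply_bcontfun w t \<in> cball x0 1}"
  define P where "P = (\<lambda>w. Bcontfun (\<lambda>t. J (apply_bcontfun w) (pr t)))"
  have pr: "pr t \<in> {-T..T}" for t using T by (auto simp: pr_def)
  have J_deriv: "(J w has_vector_derivative G (w t)) (at t within {-T..T})"
    if "w \<in> S" "t \<in> {-T..T}" for w :: "real \<Rightarrow>\<^sub>C 'a" and t
  proof -
    have "continuous_on {-T..T} (\<lambda>s. G (w s))"
      using \<open>w \<in> S\<close> by (intro continuous_on_compose2[OF lipschitz_on_continuous_on[OF L]]
        continuous_intros) (auto simp: S_def)
    then have "(I w has_vector_derivative G (w t)) (at t within {-T..T})"
      unfolding I_def using that(2) by (rule integral_has_vector_derivative)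
    then show ?thesis unfolding J_def by (auto intro!: derivative_eq_intros)
  qed
  have J0: "J w 0 = f" for w by (simp add: J_def)
  have bound: "norm (J w t - f) \<le> 1 / 2" if w: "w \<in> S" and t: "t \<in> {-T..T}" for w :: "real \<Rightarrow>\<^sub>C 'a" and t
  proof -
    have "norm (J w t - J w 0) \<le> M * \<bar>t - 0\<bar>"
      using w t T by (intro vector_derivative_increment_bound[of "{-T..T}" _ "\<lambda>s. G (w s)"] J_deriv M)
        (auto simp: S_def)
    also have "\<dots> \<le> M * T"
      using t M[of x0] norm_ge_zero[of "G x0"] by (intro mult_left_mono) (auto simp del: norm_ge_zero)
    finally show ?thesis using T by (simp add: J0 mult.commute)
  qed
  have in_ball: "J w t \<in> cball x0 1" if "w \<in> S" "t \<in> {-T..T}" for w :: "real \<Rightarrow>\<^sub>C 'a" and t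
  proof -
    have "dist x0 (J w t) \<le> dist x0 f + dist f (J w t)" by (rule dist_triangle)
    moreover have "dist f (J w t) \<le> 1 / 2"
      using bound[OF that] by (simp add: dist_norm norm_minus_commute)
    ultimately show ?thesis using f unfolding mem_cball mem_ball by linarith
  qed
  have P_apply: "apply_bcontfun (P w) t = J w (pr t)" if w: "w \<in> S" for w t
  proof -
    have "continuous_on {-T..T} (J w)"
      by (rule continuous_on_vector_derivative[OF J_deriv[OF w]])
    then have "continuous_on UNIV (\<lambda>t. J w (pr t))"
      by (rule continuous_on_compose2) (auto simp: pr_def less_imp_le[OF T(1)] intro!: continuous_intros)
    moreover have "bounded (range (\<lambda>t. J w (pr t)))"
      by (rule bounded_subset[OF bounded_cball[of x0 1]]) (use in_ball[OF w pr] in blast)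
    ultimately show ?thesis
      unfolding P_def by (simp add: Bcontfun_inverse bcontfun_def)
  qed
  have "\<exists>!w\<in>S. P w = w"
  proof (rule Banach_fix)
    show "complete S"
    proof -
      have "S = (\<Inter>t. {w. apply_bcontfun w t \<in> cball x0 1})" by (auto simp: S_def)
      moreover have "closed {w :: real \<Rightarrow>\<^sub>C 'a. apply_bcontfun w t \<in> cball x0 1}" for t
      proof -
        have "continuous_on UNIV (\<lambda>w :: real \<Rightarrow>\<^sub>C 'a. apply_bcontfun w t)"
          unfolding continuous_on_iff by (meson dist_bounded le_less_trans)
        then show ?thesis using closed_vimage[of "cball x0 1" "\<lambda>w :: real \<Rightarrow>\<^sub>C 'a. apply_bcontfun w t"]
          by (simp add: vimage_def)
      qed
      ultimately show ?thesis by (auto simp: complete_eq_closed)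
    qed
    show "S \<noteq> {}"
    proof -
      have "const_bcontfun x0 \<in> S" by (simp add: S_def)
      then show ?thesis by blast
    qed
    show "P ` S \<subseteq> S"
    proof safe
      fix w assume w: "w \<in> S"
      then have "\<forall>t. apply_bcontfun (P w) t \<in> cball x0 1"
        using in_ball[OF w pr] by (simp only: P_apply simp_thms)
      then show "P w \<in> S" unfolding S_def by blast
    qed
    show "dist (P w) (P z) \<le> (1 / 2) * dist w z" if w: "w \<in> S" and z: "z \<in> S" for w z
    proof (rule dist_bound)
      fix t
      have "norm ((J w (pr t) - J z (pr t)) - (J w 0 - J z 0)) \<le> (L * dist w z) * \<bar>pr t - 0\<bar>"
      proof (rule vector_derivative_increment_bound[of "{-T..T}" _ "\<lambda>s. G (w s) - G (z s)"])
        show "((\<lambda>t. J w t - J z t) has_vector_derivative G (w s) - G (z s)) (at s within {-T..T})"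
          if "s \<in> {-T..T}" for s
          using J_deriv[OF w that] J_deriv[OF z that] by (rule has_vector_derivative_diff)
        show "norm (G (w s) - G (z s)) \<le> L * dist w z" for s
        proof -
          have "norm (G (w s) - G (z s)) \<le> L * dist (w s) (z s)"
            using lipschitz_onD[OF L, of "w s" "z s"] w z by (simp add: S_def dist_norm)
          also have "\<dots> \<le> L * dist w z"
            using lipschitz_on_nonneg[OF L] by (intro mult_left_mono dist_bounded)
          finally show ?thesis .
        qed
      qed (use T pr in auto)
      also have "\<dots> \<le> (L * dist w z) * T"
        using pr[of t] lipschitz_on_nonneg[OF L] by (intro mult_left_mono) auto
      also have "\<dots> \<le> (1 / 2) * dist w z"
        using mult_right_mono[OF T(3), of "dist w z"] by (simp add: mult.commute mult.left_commute)
      finally show "dist (P w t) (P z t) \<le> (1 / 2) * dist w z"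
        using w z by (simp add: P_apply J0 dist_norm)
    qed
  qed auto
  then obtain w where w: "w \<in> S" "P w = w" by blast
  have eq: "w t = J w t" if "t \<in> {-T..T}" for t
    using P_apply[OF w(1), of t] w(2) that by (simp add: pr_def)
  \<comment> \<open>By construction the derivative of \<open>J w\<close> is \<open>G (w t)\<close>;
    the fixed point identity on the interval replaces \<open>w t\<close> by
    \<open>J w t\<close>.\<close>
  have "solves_ode_on G {-T..T} (J w)"
    unfolding solves_ode_on_def using J_deriv[OF w(1)] eq by simp
  moreover have "\<forall>t\<in>{-T..T}. J w t \<in> cball x0 1" using in_ball[OF w(1)] by blast
  ultimately show ?thesis using J0 by blast
qed

text \<open>The interval is so short that the increment of the difference \<open>h\<close> is at
  most half of the maximum of \<open>norm (h s)\<close>. Absorbing this half on the left leaves the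
  factor 2.\<close>

lemma ode_solution_dependence:
  fixes G :: "'a::real_normed_vector \<Rightarrow> 'a"
  assumes L: "L-lipschitz_on B G" and T: "T > 0" "T * L \<le> 1 / 2"
    and u: "solves_ode_on G {-T..T} u" "\<And>t. t \<in> {-T..T} \<Longrightarrow> u t \<in> B"
    and v: "solves_ode_on G {-T..T} v" "\<And>t. t \<in> {-T..T} \<Longrightarrow> v t \<in> B"
    and t: "t \<in> {-T..T}"
  shows "dist (u t) (v t) \<le> 2 * dist (u 0) (v 0)"
proof -
  define h where "h = (\<lambda>s. u s - v s)"
  have hc: "continuous_on {-T..T} (\<lambda>s. norm (h s))"
    unfolding h_def using solves_ode_on_continuous[OF u(1)] solves_ode_on_continuous[OF v(1)]
    by (intro continuous_intros)
  obtain t0 where t0: "t0 \<in> {-T..T}" and max: "\<And>s. s \<in> {-T..T} \<Longrightarrow> norm (h s) \<le> norm (h t0)"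
    using continuous_attains_sup[OF _ _ hc] t by force
  have "norm (h t0 - h 0) \<le> (L * norm (h t0)) * \<bar>t0 - 0\<bar>"
  proof (rule vector_derivative_increment_bound[of "{-T..T}" _ "\<lambda>s. G (u s) - G (v s)"])
    show "(h has_vector_derivative G (u s) - G (v s)) (at s within {-T..T})" if "s \<in> {-T..T}" for s
      using u(1) v(1) that unfolding solves_ode_on_def h_def by (intro has_vector_derivative_diff) auto
    show "norm (G (u s) - G (v s)) \<le> L * norm (h t0)" if s: "s \<in> {-T..T}" for s
    proof -
      have "norm (G (u s) - G (v s)) \<le> L * norm (h s)"
        using lipschitz_onD[OF L u(2)[OF s] v(2)[OF s]] by (simp add: h_def dist_norm)
      also have "\<dots> \<le> L * norm (h t0)"
        using lipschitz_on_nonneg[OF L] max[OF s] by (intro mult_left_mono)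
      finally show ?thesis .
    qed
  qed (use T t0 in auto)
  also have "\<dots> \<le> (L * norm (h t0)) * T"
    using t0 lipschitz_on_nonneg[OF L] by (intro mult_left_mono) auto
  also have "\<dots> \<le> norm (h t0) / 2"
    using mult_right_mono[OF T(2), of "norm (h t0)"] by (simp add: mult.commute mult.left_commute)
  finally have "norm (h t0) \<le> 2 * norm (h 0)"
    using norm_triangle_sub[of "h t0" "h 0"] by simp
  then show ?thesis using max[OF t] by (simp add: h_def dist_norm)
qed

theorem ode_locally_well_posed:
  fixes G :: "'a::banach \<Rightarrow> 'a"
  assumes G: "locally_lipschitz G"
  obtains r T where "r > 0" and "T > 0"
    and "\<And>f. f \<in> ball x0 r \<Longrightarrow> \<exists>u. solves_ode_on G {-T..T} u \<and> u 0 = f"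
    and "\<And>u v t. solves_ode_on G {-T..T} u \<Longrightarrow> solves_ode_on G {-T..T} v \<Longrightarrow>
      u 0 \<in> ball x0 r \<Longrightarrow> v 0 \<in> ball x0 r \<Longrightarrow> t \<in> {-T..T} \<Longrightarrow> dist (u t) (v t) \<le> 2 * dist (u 0) (v 0)"
proof -
  obtain L where "L-lipschitz_on (cball 0 (norm x0 + 1)) G"
    using G unfolding locally_lipschitz_def by blast
  moreover have "cball x0 1 \<subseteq> cball 0 (norm x0 + 1)"
  proof
    fix x assume "x \<in> cball x0 1"
    then show "x \<in> cball 0 (norm x0 + 1)"
      using norm_triangle_ineq2[of x x0] by (simp add: dist_norm norm_minus_commute)
  qed
  ultimately have L: "L-lipschitz_on (cball x0 1) G" by (rule lipschitz_on_subset)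
  note L0 = lipschitz_on_nonneg[OF L]
  define M where "M = norm (G x0) + L"
  have M: "norm (G x) \<le> M" if "x \<in> cball x0 1" for x
  proof -
    have "norm (G x) \<le> norm (G x0) + norm (G x - G x0)"
      by (rule norm_triangle_sub)
    also have "norm (G x - G x0) \<le> L * dist x x0"
      using lipschitz_onD[OF L that, of x0] by (simp add: dist_norm)
    also have "L * dist x x0 \<le> L * 1"
      using that L0 by (intro mult_left_mono) (auto simp: dist_commute)
    finally show ?thesis by (simp add: M_def)
  qed
  \<comment> \<open>\<open>M\<close> bounds both the field on the unit ball and its Lipschitz
    constant, so this choice meets both smallness conditions; the added 1 keeps the denominator
    positive.\<close>
  define T where "T = 1 / (2 * (M + 1))"
  have "M \<ge> L" "M \<ge> 0" using L0 by (auto simp: M_def)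
  then have T: "T > 0" "T * M \<le> 1 / 2" "T * L \<le> 1 / 2"
    by (auto simp: T_def field_simps)
  have ex: "\<exists>u. solves_ode_on G {-T..T} u \<and> u 0 = f \<and> (\<forall>t\<in>{-T..T}. u t \<in> cball x0 1)"
    if "f \<in> ball x0 (1 / 2)" for f
    using L M T that by (rule ode_solution_exists)
  have in_ball: "u t \<in> cball x0 1"
    if u: "solves_ode_on G {-T..T} u" "u 0 \<in> ball x0 (1/2)" and t: "t \<in> {-T..T}" for u t
  proof -
    obtain v where v: "solves_ode_on G {-T..T} v" "v 0 = u 0" "\<forall>t\<in>{-T..T}. v t \<in> cball x0 1"
      using ex[OF u(2)] by blast
    then show ?thesis
      using ode_unique[OF G u(1) v(1) _ t] t by simp
  qed
  show thesis
  proof (rule that[of "1/2" T])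
    show "\<exists>u. solves_ode_on G {-T..T} u \<and> u 0 = f" if "f \<in> ball x0 (1/2)" for f
      using ex[OF that] by blast
    show "dist (u t) (v t) \<le> 2 * dist (u 0) (v 0)"
      if "solves_ode_on G {-T..T} u" "solves_ode_on G {-T..T} v"
        "u 0 \<in> ball x0 (1/2)" "v 0 \<in> ball x0 (1/2)" "t \<in> {-T..T}" for u v t
      by (rule ode_solution_dependence[OF L T(1,3) that(1) in_ball[OF that(1,3)]
          that(2) in_ball[OF that(2,4)] that(5)])
  qed (use T in auto)
qed

section \<open>Operations preserving Lipschitz continuity on balls\<close>

lemma locally_lipschitz_id: "locally_lipschitz (\<lambda>x. x)"
  unfolding locally_lipschitz_def by (auto intro!: exI[of _ 1] lipschitz_onI)

lemma locally_lipschitz_add: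
  assumes "locally_lipschitz f" "locally_lipschitz g"
  shows "locally_lipschitz (\<lambda>x. f x + g x)"
  unfolding locally_lipschitz_def
proof
  fix R
  obtain L M where "L-lipschitz_on (cball 0 R) f" "M-lipschitz_on (cball 0 R) g"
    using assms unfolding locally_lipschitz_def by blast
  then have "(L + M)-lipschitz_on (cball 0 R) (\<lambda>x. f x + g x)" by (rule lipschitz_on_add)
  then show "\<exists>L. L-lipschitz_on (cball 0 R) (\<lambda>x. f x + g x)" ..
qed

text \<open>Provides the continuity of the derivative of a solution, since that derivative is the
  field evaluated along a continuous curve.\<close>

lemma locally_lipschitz_continuous:
  assumes "locally_lipschitz G"
  shows "continuous_on UNIV G"
proof -
  have "continuous_on (ball x 1) G" for x
  proof -
    obtain L where "L-lipschitz_on (cball 0 (norm x + 1)) G"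
      using assms unfolding locally_lipschitz_def by blast
    moreover have "ball x 1 \<subseteq> cball 0 (norm x + 1)"
    proof
      fix y assume "y \<in> ball x 1"
      then show "y \<in> cball 0 (norm x + 1)"
        using norm_triangle_ineq2[of y x] by (simp add: dist_norm norm_minus_commute)
    qed
    ultimately show ?thesis
      by (meson lipschitz_on_continuous_on lipschitz_on_subset)
  qed
  then have "continuous_on (\<Union>x. ball x 1) G"
    by (intro continuous_on_open_UN) auto
  moreover have "(\<Union>x. ball x 1) = (UNIV :: 'a set)" by (auto intro: centre_in_ball[THEN iffD2])
  ultimately show ?thesis by simp
qed

lemma lipschitz_on_cball_bounded:
  fixes f :: "'a::real_normed_vector \<Rightarrow> 'b::real_normed_vector"
  assumes L: "L-lipschitz_on (cball 0 R) f"
  shows "\<exists>M>0. \<forall>x\<in>cball 0 R. norm (f x) \<le> M"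
proof (intro exI[of _ "norm (f 0) + L * \<bar>R\<bar> + 1"] conjI ballI)
  fix x :: 'a assume x: "x \<in> cball 0 R"
  then have "0 \<in> cball 0 R" by (auto intro: order_trans[OF norm_ge_zero[of x]])
  then have "norm (f x - f 0) \<le> L * norm x"
    using lipschitz_onD[OF L x, of 0] by (simp add: dist_norm)
  also have "\<dots> \<le> L * \<bar>R\<bar>"
    using x lipschitz_on_nonneg[OF L] by (intro mult_left_mono) auto
  finally show "norm (f x) \<le> norm (f 0) + L * \<bar>R\<bar> + 1"
    using norm_triangle_sub[of "f x" "f 0"] by simp
next
  show "0 < norm (f 0) + L * \<bar>R\<bar> + 1"
    using lipschitz_on_nonneg[OF L] by (simp add: add_nonneg_pos)
qed

text \<open>Changing one argument at a time bounds the difference by the Lipschitz constant of one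
  factor times the bound of the other on the ball. By induction this covers the powers in the
  nonlinearity.\<close>

lemma locally_lipschitz_bilinear:
  fixes B :: "'a::real_normed_vector \<Rightarrow> 'a \<Rightarrow> 'a"
  assumes B: "bounded_bilinear B" and f: "locally_lipschitz f" and g: "locally_lipschitz g"
  shows "locally_lipschitz (\<lambda>x. B (f x) (g x))"
  unfolding locally_lipschitz_def
proof
  fix R
  interpret B: bounded_bilinear B by (rule B)
  obtain K where K: "0 \<le> K" "\<And>x y. norm (B x y) \<le> norm x * norm y * K"
    using B.nonneg_bounded by blast
  obtain Lf where Lf: "Lf-lipschitz_on (cball 0 R) f"
    using f unfolding locally_lipschitz_def by blast
  obtain Lg where Lg: "Lg-lipschitz_on (cball 0 R) g"
    using g unfolding locally_lipschitz_def by blast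
  obtain Mf where Mf: "0 < Mf" "\<And>x. x \<in> cball 0 R \<Longrightarrow> norm (f x) \<le> Mf"
    using lipschitz_on_cball_bounded[OF Lf] by blast
  obtain Mg where Mg: "0 < Mg" "\<And>x. x \<in> cball 0 R \<Longrightarrow> norm (g x) \<le> Mg"
    using lipschitz_on_cball_bounded[OF Lg] by blast
  note nonneg = lipschitz_on_nonneg[OF Lf] lipschitz_on_nonneg[OF Lg] K(1)
  have "((Lf * Mg + Mf * Lg) * K)-lipschitz_on (cball 0 R) (\<lambda>x. B (f x) (g x))"
  proof (rule lipschitz_onI)
    fix x y :: 'a assume x: "x \<in> cball 0 R" and y: "y \<in> cball 0 R"
    have "B (f x) (g x) - B (f y) (g y) = B (f x - f y) (g x) + B (f y) (g x - g y)"
      by (simp add: B.diff_left B.diff_right)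
    then have "norm (B (f x) (g x) - B (f y) (g y)) \<le> norm (B (f x - f y) (g x)) + norm (B (f y) (g x - g y))"
      by (simp only: norm_triangle_ineq)
    also have "\<dots> \<le> norm (f x - f y) * norm (g x) * K + norm (f y) * norm (g x - g y) * K"
      by (intro add_mono K(2))
    also have "\<dots> \<le> (Lf * dist x y) * Mg * K + Mf * (Lg * dist x y) * K"
      using lipschitz_onD[OF Lf x y] lipschitz_onD[OF Lg x y] Mf(2)[OF y] Mg(2)[OF x] nonneg Mf(1)
      by (intro add_mono mult_right_mono mult_mono) (auto simp: dist_norm)
    finally show "dist (B (f x) (g x)) (B (f y) (g y)) \<le> (Lf * Mg + Mf * Lg) * K * dist x y"
      by (simp add: dist_norm algebra_simps)
  qed (use nonneg Mf(1) Mg(1) in simp)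
  then show "\<exists>L. L-lipschitz_on (cball 0 R) (\<lambda>x. B (f x) (g x))" ..
qed

lemma locally_lipschitz_linear:
  assumes T: "bounded_linear T" and f: "locally_lipschitz f"
  shows "locally_lipschitz (\<lambda>x. T (f x))"
  unfolding locally_lipschitz_def
proof
  fix R
  obtain B where B: "B-lipschitz_on UNIV T"
    using bounded_linear.lipschitz_boundE[OF T] .
  obtain L where L: "L-lipschitz_on (cball 0 R) f"
    using f unfolding locally_lipschitz_def by blast
  have "(B * L)-lipschitz_on (cball 0 R) (\<lambda>x. T (f x))"
    by (rule lipschitz_on_compose2[OF L lipschitz_on_subset[OF B]]) simp
  then show "\<exists>L. L-lipschitz_on (cball 0 R) (\<lambda>x. T (f x))" ..
qed

text \<open>Puts the derivative of the type class into the form of \<open>has_VR_derivative\<close>,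
  a limit of difference quotients. The value of the quotient at \<open>s = t\<close> does not
  matter, as the filter omits \<open>t\<close>.\<close>

lemma has_vector_derivative_iff_quotient:
  fixes f :: "real \<Rightarrow> 'a::real_normed_vector"
  shows "(f has_vector_derivative v) (at t within S) \<longleftrightarrow>
    ((\<lambda>s. (f s - f t) /\<^sub>R (s - t)) \<longlongrightarrow> v) (at t within S)"
proof -
  have eq: "norm (f s - f t - (s - t) *\<^sub>R v) / norm (s - t) = norm ((f s - f t) /\<^sub>R (s - t) - v)"
    if "s \<noteq> t" for s
  proof -
    have "f s - f t - (s - t) *\<^sub>R v = (s - t) *\<^sub>R ((f s - f t) /\<^sub>R (s - t) - v)"
      using that by (simp add: scaleR_diff_right)
    then show ?thesis using that by simp
  qed
  have "(f has_vector_derivative v) (at t within S) \<longleftrightarrow>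
      ((\<lambda>s. norm (f s - f t - (s - t) *\<^sub>R v) / norm (s - t)) \<longlongrightarrow> 0) (at t within S)"
    unfolding has_vector_derivative_def has_derivative_iff_norm
    by (simp add: bounded_linear_scaleR_left)
  also have "\<dots> \<longleftrightarrow> ((\<lambda>s. norm ((f s - f t) /\<^sub>R (s - t) - v)) \<longlongrightarrow> 0) (at t within S)"
    by (rule filterlim_cong[OF refl refl]) 
      (unfold eventually_at_filter, intro always_eventually allI impI eq)
  finally show ?thesis
    unfolding tendsto_norm_zero_iff LIM_zero_iff .
qed

lemma atin_top_of_set: "t \<in> S \<Longrightarrow> atin (top_of_set S) t = at t within S"
  by (auto simp: filter_eq_iff atin_subtopology_within eventually_atin_within eventually_at_topological)

section \<open>Hermitian summable families\<close>

text \<open>Both \<open>Infinite_Sum\<close> and \<open>Infinite_Set_Sum\<close> claim this notation; the former is meant.\<close>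

no_notation Infinite_Set_Sum.abs_summable_on (infix "abs'_summable'_on" 50)

text \<open>The members are the weighted coefficients. Hermitian symmetry encodes that the
  represented function is real-valued; it survives real scalars but not multiplication by the
  imaginary unit, so the type is made a real vector space.\<close>

typedef (overloaded) ('n::finite) herm_l1 =
  "{b :: int ^ 'n \<Rightarrow> complex. (\<lambda>n. cmod (b n)) summable_on UNIV \<and> (\<forall>n. b (- n) = cnj (b n))}"
  morphisms coeff Herm_l1
  by (rule exI[of _ "\<lambda>_. 0"]) simp

setup_lifting type_definition_herm_l1

lemma coeff_summable: "(\<lambda>n. cmod (coeff b n)) summable_on UNIV"
  and coeff_minus_index: "coeff b (- n) = cnj (coeff b n)"
  using coeff[of b] by auto

lemma herm_l1_eqI: "(\<And>n. coeff b n = coeff c n) \<Longrightarrow> b = c"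
  by (simp add: coeff_inject[symmetric] fun_eq_iff)

lemma coeff_Herm_l1:
  assumes "(\<lambda>n. cmod (b n)) summable_on UNIV" "\<And>n. b (- n) = cnj (b n)"
  shows "coeff (Herm_l1 b) = b"
  using assms by (simp add: Herm_l1_inverse)

lemma summable_on_norm_add:
  fixes f g :: "'i \<Rightarrow> 'a::real_normed_vector"
  assumes "f abs_summable_on A" "g abs_summable_on A"
  shows "(\<lambda>x. f x + g x) abs_summable_on A"
  by (rule summable_on_comparison_test[OF summable_on_add[OF assms]])
    (auto intro: norm_triangle_ineq)

instantiation herm_l1 :: (finite) real_vector
begin

lift_definition zero_herm_l1 :: "'a herm_l1" is "\<lambda>_. 0" by simp

lift_definition plus_herm_l1 :: "'a herm_l1 \<Rightarrow> 'a herm_l1 \<Rightarrow> 'a herm_l1" is "\<lambda>b c n. b n + c n"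
  by (simp add: summable_on_norm_add)

lift_definition uminus_herm_l1 :: "'a herm_l1 \<Rightarrow> 'a herm_l1" is "\<lambda>b n. - b n"
  by simp

definition minus_herm_l1 :: "'a herm_l1 \<Rightarrow> 'a herm_l1 \<Rightarrow> 'a herm_l1" where
  "minus_herm_l1 b c = b + (- c)"

lift_definition scaleR_herm_l1 :: "real \<Rightarrow> 'a herm_l1 \<Rightarrow> 'a herm_l1" is "\<lambda>r b n. r *\<^sub>R b n"
  by (auto simp: summable_on_cmult_right norm_mult scaleR_conv_of_real)

instance
proof
  fix a b c :: "'a herm_l1" and r s :: real
  show "a + b + c = a + (b + c)" "a + b = b + a" "0 + a = a" "- a + a = 0"
    "r *\<^sub>R (a + b) = r *\<^sub>R a + r *\<^sub>R b" "(r + s) *\<^sub>R a = r *\<^sub>R a + s *\<^sub>R a"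
    "r *\<^sub>R s *\<^sub>R a = (r * s) *\<^sub>R a" "1 *\<^sub>R a = a"
    by (transfer; simp add: fun_eq_iff algebra_simps)+
qed (simp add: minus_herm_l1_def)

end

lemma coeff_zero [simp]: "coeff 0 n = 0"
  and coeff_add [simp]: "coeff (b + c) n = coeff b n + coeff c n"
  and coeff_uminus [simp]: "coeff (- b) n = - coeff b n"
  and coeff_scaleR [simp]: "coeff (r *\<^sub>R b) n = r *\<^sub>R coeff b n"
  by (transfer; simp)+

lemma coeff_diff [simp]: "coeff (b - c) n = coeff b n - coeff c n"
  by (simp only: minus_herm_l1_def coeff_add coeff_uminus) simp

instantiation herm_l1 :: (finite) real_normed_vector
begin

definition norm_herm_l1 :: "'a herm_l1 \<Rightarrow> real" where
  "norm_herm_l1 b = (\<Sum>\<^sub>\<infinity>n. cmod (coeff b n))"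

definition sgn_herm_l1 :: "'a herm_l1 \<Rightarrow> 'a herm_l1" where
  "sgn_herm_l1 b = b /\<^sub>R norm b"

definition dist_herm_l1 :: "'a herm_l1 \<Rightarrow> 'a herm_l1 \<Rightarrow> real" where
  "dist_herm_l1 b c = norm (b - c)"

definition uniformity_herm_l1 :: "('a herm_l1 \<times> 'a herm_l1) filter" where
  "uniformity_herm_l1 = (INF e\<in>{0<..}. principal {(b, c). dist b c < e})"

definition open_herm_l1 :: "'a herm_l1 set \<Rightarrow> bool" where
  "open_herm_l1 U = (\<forall>b\<in>U. eventually (\<lambda>(b', c). b' = b \<longrightarrow> c \<in> U) uniformity)"

instance
proof
  fix b c :: "'a herm_l1" and r :: real
  show "(norm b = 0) = (b = 0)"
  proof
    assume "norm b = 0"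
    then have "coeff b n = 0" for n
      using coeff_summable[of b] nonneg_infsum_le_0D[of "\<lambda>n. cmod (coeff b n)" UNIV n]
      by (simp add: norm_herm_l1_def)
    then show "b = 0" by (intro herm_l1_eqI) simp
  qed (simp add: norm_herm_l1_def)
  have "norm (b + c) \<le> (\<Sum>\<^sub>\<infinity>n. cmod (coeff b n) + cmod (coeff c n))"
    unfolding norm_herm_l1_def
    by (rule infsum_mono[OF coeff_summable summable_on_add[OF coeff_summable coeff_summable]])
      (simp add: norm_triangle_ineq)
  then show "norm (b + c) \<le> norm b + norm c"
    by (simp add: norm_herm_l1_def infsum_add coeff_summable)
  show "norm (r *\<^sub>R b) = \<bar>r\<bar> * norm b"
    by (simp add: norm_herm_l1_def infsum_cmult_right coeff_summable)
  show "sgn b = b /\<^sub>R norm b" by (rule sgn_herm_l1_def)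
  show "dist b c = norm (b - c)" by (rule dist_herm_l1_def)
  show "uniformity = (INF e\<in>{0<..}. principal {(b :: 'a herm_l1, c). dist b c < e})"
    by (rule uniformity_herm_l1_def)
  show "open U = (\<forall>b\<in>U. eventually (\<lambda>(b', c). b' = b \<longrightarrow> c \<in> U) uniformity)"
    for U :: "'a herm_l1 set"
    by (rule open_herm_l1_def)
qed

end

lemma norm_coeff_le: "cmod (coeff b n) \<le> norm b"
  using finite_sum_le_infsum[OF coeff_summable[of b], of "{n}"] by (simp add: norm_herm_l1_def)

instance herm_l1 :: (finite) banach
proof
  fix X :: "nat \<Rightarrow> 'a herm_l1"
  assume "Cauchy X"
  have "Cauchy (\<lambda>j. coeff (X j) n)" for n
  proof (rule CauchyI)
    fix e :: real assume "0 < e"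
    then obtain N where N: "\<And>i j. i \<ge> N \<Longrightarrow> j \<ge> N \<Longrightarrow> norm (X i - X j) < e"
      using CauchyD[OF \<open>Cauchy X\<close>] by blast
    have "norm (coeff (X i) n - coeff (X j) n) < e" if "i \<ge> N" "j \<ge> N" for i j
      using le_less_trans[OF norm_coeff_le[of "X i - X j" n] N[OF that]] by simp
    then show "\<exists>N. \<forall>i\<ge>N. \<forall>j\<ge>N. norm (coeff (X i) n - coeff (X j) n) < e" by blast
  qed
  then have "\<forall>n. \<exists>y. (\<lambda>j. coeff (X j) n) \<longlonglongrightarrow> y"
    unfolding Cauchy_convergent_iff convergent_def by blast
  then obtain l where l: "\<And>n. (\<lambda>j. coeff (X j) n) \<longlonglongrightarrow> l n"
    unfolding choice_iff by blast
  \<comment> \<open>Working with finite \<open>F\<close>, and a threshold \<open>N\<close>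
    independent of \<open>F\<close>, lets the limit in \<open>j\<close> be taken term by term; the
    bound then passes to the infinite sum. The strict inequality becomes weak in the limit.\<close>
  have tail: "\<exists>N. \<forall>i\<ge>N. \<forall>F. finite F \<longrightarrow> (\<Sum>n\<in>F. cmod (coeff (X i) n - l n)) \<le> e" if "0 < e" for e
  proof -
    obtain N where N: "\<And>i j. i \<ge> N \<Longrightarrow> j \<ge> N \<Longrightarrow> norm (X i - X j) < e"
      using CauchyD[OF \<open>Cauchy X\<close> \<open>0 < e\<close>] by blast
    have "(\<Sum>n\<in>F. cmod (coeff (X i) n - l n)) \<le> e" if "i \<ge> N" "finite F" for i F
    proof (rule LIMSEQ_le_const2)
      show "(\<lambda>j. \<Sum>n\<in>F. cmod (coeff (X i) n - coeff (X j) n)) \<longlonglongrightarrow> (\<Sum>n\<in>F. cmod (coeff (X i) n - l n))"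
        by (intro tendsto_intros l)
      have "(\<Sum>n\<in>F. cmod (coeff (X i) n - coeff (X j) n)) \<le> e" if "j \<ge> N" for j
      proof -
        have "(\<Sum>n\<in>F. cmod (coeff (X i - X j) n)) \<le> norm (X i - X j)"
          unfolding norm_herm_l1_def
          using finite_sum_le_infsum[OF coeff_summable[of "X i - X j"] \<open>finite F\<close>] by simp
        then show ?thesis using N[OF \<open>i \<ge> N\<close> \<open>j \<ge> N\<close>] by simp
      qed
      then show "\<exists>N. \<forall>j\<ge>N. (\<Sum>n\<in>F. cmod (coeff (X i) n - coeff (X j) n)) \<le> e"
        by (intro exI[of _ N]) simp
    qed
    then show ?thesis by (intro exI[of _ N]) simp
  qed
  define b where "b = Herm_l1 l"
  have b: "coeff b = l"
    unfolding b_def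
  proof (rule coeff_Herm_l1)
    obtain N where N: "\<And>F. finite F \<Longrightarrow> (\<Sum>n\<in>F. cmod (coeff (X N) n - l n)) \<le> 1"
      using tail[OF zero_less_one] order_refl by blast
    have "(\<lambda>n. cmod (coeff (X N) n - l n)) summable_on UNIV"
      by (rule nonneg_bdd_above_summable_on) (auto simp: bdd_above_def intro!: exI[of _ 1] N)
    then have "(\<lambda>n. cmod (coeff (X N) n + - (coeff (X N) n - l n))) summable_on UNIV"
      by (intro summable_on_norm_add coeff_summable) (simp only: norm_minus_cancel)
    then show "(\<lambda>n. cmod (l n)) summable_on UNIV" by simp
    show "l (- n) = cnj (l n)" for n
      using l[of "- n"] tendsto_cnj[OF l[of n]]
      unfolding coeff_minus_index by (rule LIMSEQ_unique)
  qed
  have "X \<longlonglongrightarrow> b"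
  proof (rule LIMSEQ_I)
    fix e :: real assume "0 < e"
    then obtain N where N: "\<And>i F. i \<ge> N \<Longrightarrow> finite F \<Longrightarrow> (\<Sum>n\<in>F. cmod (coeff (X i) n - l n)) \<le> e / 2"
      using tail[of "e / 2"] half_gt_zero by blast
    have "norm (X i - b) \<le> e / 2" if "i \<ge> N" for i
      unfolding norm_herm_l1_def by (rule infsum_le_finite_sums[OF coeff_summable])
        (unfold b coeff_diff, rule N[OF that])
    then show "\<exists>N. \<forall>i\<ge>N. norm (X i - b) < e"
      using \<open>0 < e\<close> by (intro exI[of _ N]) (auto intro: le_less_trans[of _ "e / 2"])
  qed
  then show "convergent X" by (rule convergentI)
qed

section \<open>Quasi-periodic Fourier series\<close>

lemma real_vec_add: "real_vec (m + n) = real_vec m + real_vec n"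
  and real_vec_minus: "real_vec (- n) = - real_vec n"
  by (simp_all add: real_vec_def vec_eq_iff)

lemma freq_add: "freq \<omega> (m + n) = freq \<omega> m + freq \<omega> n"
  and freq_minus: "freq \<omega> (- n) = - freq \<omega> n"
  by (simp_all add: freq_def real_vec_add real_vec_minus inner_add_right)

text \<open>This is the form in which independence over the integers is used: modes with equal
  frequencies would have the same wave, and only the sum of their coefficients could be
  recovered.\<close>

lemma freq_inj:
  assumes "Z_independent \<omega>" "freq \<omega> m = freq \<omega> n"
  shows "m = n"
proof -
  have "freq \<omega> (m + - n) = 0" using assms(2) by (simp only: freq_add freq_minus)
  then have "(\<Sum>i\<in>UNIV. of_int ((m + - n) $ i) * \<omega> $ i) = 0"
    by (simp add: freq_def inner_vec_def real_vec_def mult.commute)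
  then have "m + - n = 0" using assms(1) unfolding Z_independent_def by blast
  then show ?thesis by simp
qed

definition wave :: "real ^ 'n \<Rightarrow> int ^ 'n \<Rightarrow> real \<Rightarrow> complex" where
  "wave \<omega> n x = exp (\<i> * of_real (freq \<omega> n * x))"

lemma fourier_series_wave: "fourier_series \<omega> a x = (\<Sum>\<^sub>\<infinity>n. a n * wave \<omega> n x)"
  by (simp add: fourier_series_def wave_def)

lemma norm_wave [simp]: "cmod (wave \<omega> n x) = 1"
  by (simp add: wave_def)

lemma wave_add_index: "wave \<omega> (m + n) x = wave \<omega> m x * wave \<omega> n x"
  by (simp add: wave_def freq_add distrib_right distrib_left exp_add)

lemma wave_minus_index: "wave \<omega> (- n) x = cnj (wave \<omega> n x)"
  by (simp add: wave_def freq_minus exp_cnj)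

lemma wave_add: "wave \<omega> n (x + y) = wave \<omega> n x * wave \<omega> n y"
  by (simp add: wave_def distrib_left exp_add)

lemma abs_summable_wave:
  "a abs_summable_on UNIV \<Longrightarrow> (\<lambda>n. a n * wave \<omega> n x) abs_summable_on UNIV"
  by (simp add: norm_mult)

lemma summable_wave:
  "a abs_summable_on UNIV \<Longrightarrow> (\<lambda>n. a n * wave \<omega> n x) summable_on UNIV"
  by (rule abs_summable_summable[OF abs_summable_wave])

text \<open>Averaging \<open>x\<close> and \<open>x + h\<close>, with \<open>h\<close> chosen so that the wave to be removed is in antiphase
  with the wave \<open>m\<close> to be kept, multiplies the coefficients by numbers of modulus at most one.\<close>

lemma isolate_coefficient:
  assumes \<omega>: "Z_independent \<omega>" and a: "a abs_summable_on UNIV"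
    and zero: "\<And>x. fourier_series \<omega> a x = 0" and "finite F" "m \<notin> F"
  shows "\<exists>c. c m = 1 \<and> (\<forall>n\<in>F. c n = 0) \<and> (\<forall>n. cmod (c n) \<le> 1) \<and>
    (\<forall>x. fourier_series \<omega> (\<lambda>n. c n * a n) x = 0)"
  using \<open>finite F\<close> \<open>m \<notin> F\<close>
proof (induction F)
  case empty
  then show ?case using zero by (intro exI[of _ "\<lambda>_. 1"]) simp
next
  case (insert q F)
  then obtain c where c: "c m = 1" "\<And>n. n \<in> F \<Longrightarrow> c n = 0" "\<And>n. cmod (c n) \<le> 1"
    "\<And>x. fourier_series \<omega> (\<lambda>n. c n * a n) x = 0" by auto
  have "freq \<omega> q - freq \<omega> m \<noteq> 0" using freq_inj[OF \<omega>] insert.prems by fastforce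
  define h where "h = pi / (freq \<omega> q - freq \<omega> m)"
  \<comment> \<open>The translate is multiplied by \<open>cnj (wave \<omega> m h)\<close> to undo
    the phase it gives to the mode \<open>m\<close>, hence \<open>d m = 1\<close>. As a mean of two
    numbers of modulus 1, \<open>d n\<close> has modulus at most 1.\<close>
  define d where "d = (\<lambda>n. (1 + wave \<omega> n h * cnj (wave \<omega> m h)) / 2)"
  have "wave \<omega> q h * cnj (wave \<omega> m h) = exp (\<i> * of_real ((freq \<omega> q - freq \<omega> m) * h))"
    by (simp add: wave_def exp_cnj left_diff_distrib right_diff_distrib flip: exp_add)
  also have "\<dots> = -1"
    using \<open>freq \<omega> q - freq \<omega> m \<noteq> 0\<close> by (simp add: h_def)
  finally have dq: "d q = 0" by (simp add: d_def)
  have dm: "d m = 1" by (simp add: d_def complex_norm_square[symmetric])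
  have dn: "cmod (d n) \<le> 1" for n
    using norm_triangle_ineq[of 1 "wave \<omega> n h * cnj (wave \<omega> m h)"] by (simp add: d_def norm_mult norm_divide)
  have "fourier_series \<omega> (\<lambda>n. (d n * c n) * a n) x = 0" for x
  proof -
    have ca: "(\<lambda>n. c n * a n) abs_summable_on UNIV"
      by (rule summable_on_comparison_test[OF a]) (auto simp: norm_mult intro: mult_left_le_one_le c(3))
    have "((\<lambda>n. (c n * a n) * wave \<omega> n y) has_sum 0) UNIV" for y
      using has_sum_infsum[OF summable_wave[OF ca, of \<omega> y]] c(4)[of y] by (simp add: fourier_series_wave)
    from has_sum_add[OF this[of x] has_sum_cmult_left[OF this[of "x + h"], of "cnj (wave \<omega> m h)"]]
    moreover have "c n * a n * wave \<omega> n x + c n * a n * wave \<omega> n (x + h) * cnj (wave \<omega> m h) =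
        2 * ((d n * c n * a n) * wave \<omega> n x)" for n
      by (simp add: d_def wave_add field_simps)
    ultimately have "((\<lambda>n. 2 * ((d n * c n * a n) * wave \<omega> n x)) has_sum 0) UNIV"
      by simp
    from has_sum_cmult_right[OF this, of "1/2"] have "((\<lambda>n. (d n * c n * a n) * wave \<omega> n x) has_sum 0) UNIV"
      by simp
    then show ?thesis unfolding fourier_series_wave by (rule infsumI)
  qed
  moreover have "cmod (d n * c n) \<le> 1" for n
    using dn[of n] c(3)[of n] by (simp add: norm_mult mult_le_one)
  ultimately show ?case
    using c dq dm by (intro exI[of _ "\<lambda>n. d n * c n"]) auto
qed

text \<open>Choose a finite \<open>Y\<close> containing \<open>m\<close> outside which the moduli
  sum to less than \<open>cmod (a m)\<close>, and remove all modes of \<open>Y\<close> other than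
  \<open>m\<close>. At \<open>x = 0\<close> every wave equals 1, so \<open>a m\<close> is cancelled
  by the remaining tail. As the multipliers \<open>c n\<close> do not enlarge it, that tail is too
  small.\<close>

lemma fourier_series_eq_0D:
  assumes \<omega>: "Z_independent \<omega>" and a: "a abs_summable_on UNIV"
    and zero: "\<And>x. fourier_series \<omega> a x = 0"
  shows "a m = 0"
proof (rule ccontr)
  assume "a m \<noteq> 0"
  let ?e = "cmod (a m)"
  have "((\<lambda>n. cmod (a n)) has_sum (\<Sum>\<^sub>\<infinity>n. cmod (a n))) UNIV"
    using a by (rule has_sum_infsum)
  then have "\<forall>\<^sub>F Y in finite_subsets_at_top UNIV. dist (\<Sum>n\<in>Y. cmod (a n)) (\<Sum>\<^sub>\<infinity>n. cmod (a n)) < ?e"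
    unfolding has_sum_def by (rule tendstoD) (simp add: \<open>a m \<noteq> 0\<close>)
  then obtain F where F: "finite F" "\<And>Y. finite Y \<Longrightarrow> F \<subseteq> Y \<Longrightarrow> dist (\<Sum>n\<in>Y. cmod (a n)) (\<Sum>\<^sub>\<infinity>n. cmod (a n)) < ?e"
    unfolding eventually_finite_subsets_at_top by auto
  define Y where "Y = insert m F"
  have Y: "finite Y" "m \<in> Y" using F(1) by (auto simp: Y_def)
  have split: "(\<Sum>\<^sub>\<infinity>n. cmod (a n)) = (\<Sum>n\<in>Y. cmod (a n)) + (\<Sum>\<^sub>\<infinity>n\<in>-Y. cmod (a n))"
    using infsum_Un_disjoint[of "\<lambda>n. cmod (a n)" Y "- Y"] Y(1) summable_on_subset_banach[OF a, of "- Y"]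
    by simp
  have tail: "(\<Sum>\<^sub>\<infinity>n\<in>-Y. cmod (a n)) < ?e"
  proof -
    have "dist (\<Sum>n\<in>Y. cmod (a n)) (\<Sum>\<^sub>\<infinity>n. cmod (a n)) < ?e"
      using F(2)[OF Y(1)] by (auto simp: Y_def)
    then show ?thesis unfolding split dist_real_def by linarith
  qed
  obtain c where c: "c m = 1" "\<And>n. n \<in> Y - {m} \<Longrightarrow> c n = 0" "\<And>n. cmod (c n) \<le> 1"
    "\<And>x. fourier_series \<omega> (\<lambda>n. c n * a n) x = 0"
    using isolate_coefficient[OF \<omega> a zero, of "Y - {m}" m] Y by auto
  have ca: "(\<lambda>n. c n * a n) abs_summable_on UNIV"
    by (rule summable_on_comparison_test[OF a]) (auto simp: norm_mult intro: mult_left_le_one_le c(3))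
  have caY: "(\<lambda>n. c n * a n) abs_summable_on - Y"
    using ca by (rule summable_on_subset_banach) simp
  have "0 = (\<Sum>\<^sub>\<infinity>n. c n * a n)"
    using c(4)[of 0] by (simp add: fourier_series_def)
  also have "\<dots> = (\<Sum>n\<in>Y. c n * a n) + (\<Sum>\<^sub>\<infinity>n\<in>-Y. c n * a n)"
    using infsum_Un_disjoint[of "\<lambda>n. c n * a n" Y "- Y"] Y(1) abs_summable_summable[OF caY] by simp
  also have "(\<Sum>n\<in>Y. c n * a n) = a m"
    using Y c by (simp add: sum.remove[of Y m])
  finally have "?e = cmod (\<Sum>\<^sub>\<infinity>n\<in>-Y. c n * a n)"
    by (simp add: eq_neg_iff_add_eq_0[symmetric])
  also have "\<dots> \<le> (\<Sum>\<^sub>\<infinity>n\<in>-Y. cmod (c n * a n))"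
    by (rule norm_infsum_bound[OF caY])
  also have "\<dots> \<le> (\<Sum>\<^sub>\<infinity>n\<in>-Y. cmod (a n))"
    by (rule infsum_mono[OF caY summable_on_subset_banach[OF a]])
      (auto simp: norm_mult intro: mult_left_le_one_le c(3))
  finally show False using tail by simp
qed

section \<open>Convolutions and weighted coefficient families\<close>

lemma convolution_summable:
  fixes f g :: "'i::ab_group_add \<Rightarrow> 'a::{real_normed_field, banach}"
  assumes f: "f abs_summable_on UNIV" and g: "g abs_summable_on UNIV"
  defines "h \<equiv> \<lambda>n. \<Sum>\<^sub>\<infinity>m. f m * g (n - m)"
  shows "(\<lambda>m. f m * g (n - m)) abs_summable_on UNIV"
    and "h abs_summable_on UNIV"
    and "infsum h UNIV = infsum f UNIV * infsum g UNIV"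
proof -
  have "(\<lambda>(m, l). f m * g l) abs_summable_on Sigma UNIV (\<lambda>_. UNIV)"
  proof (rule Infinite_Sum.abs_summable_on_Sigma_iff[THEN iffD2], intro conjI ballI)
    show "(\<lambda>l. case (m, l) of (m, l) \<Rightarrow> f m * g l) abs_summable_on UNIV" for m
      using g by (simp add: norm_mult summable_on_cmult_right)
    have "(\<Sum>\<^sub>\<infinity>l. norm (f m * g l)) = norm (f m) * (\<Sum>\<^sub>\<infinity>l. norm (g l))" for m
      using g by (simp add: norm_mult infsum_cmult_right)
    then show "(\<lambda>m. \<Sum>\<^sub>\<infinity>l. norm (case (m, l) of (m, l) \<Rightarrow> f m * g l)) abs_summable_on UNIV"
      using f by (simp add: abs_mult infsum_nonneg summable_on_cmult_left)
  qed
  then have fg: "(\<lambda>(m, l). f m * g l) abs_summable_on UNIV" by simp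
  \<comment> \<open>This shear turns the double family of the convolution into the family of all
    products \<open>f m * g l\<close>. Iterated summation of the first yields summability of
    \<open>h\<close>, that of the second the factorisation of the sum.\<close>
  have bij: "bij_betw (\<lambda>(n, m). (m, n - m)) UNIV (UNIV :: ('i \<times> 'i) set)"
    by (rule bij_betw_byWitness[of _ "\<lambda>(m, l). (m + l, m)"]) auto
  have FG: "(\<lambda>(n, m). f m * g (n - m)) abs_summable_on Sigma UNIV (\<lambda>_. UNIV)"
    using fg summable_on_reindex_bij_betw[OF bij, of "\<lambda>p. norm (case p of (m, l) \<Rightarrow> f m * g l)"]
    by (simp add: case_prod_unfold)
  then show 1: "(\<lambda>m. f m * g (n - m)) abs_summable_on UNIV" for n
    unfolding Infinite_Sum.abs_summable_on_Sigma_iff by simp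
  have "(\<lambda>n. \<Sum>\<^sub>\<infinity>m. norm (f m * g (n - m))) summable_on UNIV"
    using FG unfolding Infinite_Sum.abs_summable_on_Sigma_iff by (simp add: infsum_nonneg)
  then show "h abs_summable_on UNIV"
    by (rule summable_on_comparison_test) (auto simp: h_def intro: norm_infsum_bound 1)
  have "infsum h UNIV = infsum (\<lambda>(n, m). f m * g (n - m)) (Sigma UNIV (\<lambda>_. UNIV))"
    unfolding h_def using infsum_Sigma_banach[OF abs_summable_summable[OF FG]] by simp
  also have "\<dots> = infsum (\<lambda>(m, l). f m * g l) UNIV"
    using infsum_reindex_bij_betw[OF bij, of "\<lambda>(m, l). f m * g l"] by (simp add: case_prod_unfold)
  also have "\<dots> = (\<Sum>\<^sub>\<infinity>m. \<Sum>\<^sub>\<infinity>l. f m * g l)"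
    using infsum_Sigma_banach[of "\<lambda>(m, l). f m * g l" UNIV "\<lambda>_. UNIV"] abs_summable_summable[OF fg] by simp
  also have "\<dots> = infsum f UNIV * infsum g UNIV"
    using abs_summable_summable[OF f] abs_summable_summable[OF g]
    by (simp add: infsum_cmult_right infsum_cmult_left)
  finally show "infsum h UNIV = infsum f UNIV * infsum g UNIV" .
qed

lemma weight_pos [simp]: "0 < weight k n"
  by (simp add: weight_def)

lemma weight_nonzero [simp]: "weight k n \<noteq> 0"
  by (simp add: weight_def)

lemma weight_ge_1: "0 \<le> k \<Longrightarrow> 1 \<le> weight k n"
  by (simp add: weight_def)

lemma weight_minus [simp]: "weight k (- n) = weight k n"
  by (simp add: weight_def real_vec_minus)

lemma weight_add_le: "0 \<le> k \<Longrightarrow> weight k (m + n) \<le> weight k m * weight k n"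
  by (simp add: weight_def real_vec_add norm_triangle_ineq mult_left_mono flip: exp_add distrib_left)

lemma has_coeffs_abs_summable:
  assumes "0 \<le> k" "has_coeffs \<omega> k u a"
  shows "a abs_summable_on UNIV"
proof (rule summable_on_comparison_test)
  show "(\<lambda>n. cmod (a n) * weight k n) summable_on UNIV"
    using assms(2) by (simp add: has_coeffs_def)
  show "cmod (a n) \<le> cmod (a n) * weight k n" for n
    using mult_left_mono[OF weight_ge_1[OF assms(1), of n], of "cmod (a n)"] by simp
qed simp

lemma has_coeffs_unique:
  assumes \<omega>: "Z_independent \<omega>" and k: "0 \<le> k"
    and a: "has_coeffs \<omega> k u a" and b: "has_coeffs \<omega> k u b"
  shows "a = b"
proof
  fix n
  note abs = has_coeffs_abs_summable[OF k a] has_coeffs_abs_summable[OF k b]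
  have "(\<lambda>n. a n - b n) abs_summable_on UNIV"
    using summable_on_norm_add[OF abs(1), of "\<lambda>n. - b n"] abs(2) by simp
  moreover have "fourier_series \<omega> (\<lambda>n. a n - b n) x = 0" for x
  proof -
    have "fourier_series \<omega> (\<lambda>n. a n - b n) x = (\<Sum>\<^sub>\<infinity>n. a n * wave \<omega> n x + - (b n * wave \<omega> n x))"
      by (simp add: fourier_series_wave left_diff_distrib)
    also have "\<dots> = fourier_series \<omega> a x + - fourier_series \<omega> b x"
      unfolding fourier_series_wave infsum_uminus[symmetric]
      by (intro infsum_add summable_on_uminus[THEN iffD2] summable_wave abs)
    finally have "fourier_series \<omega> (\<lambda>n. a n - b n) x = fourier_series \<omega> a x + - fourier_series \<omega> b x" .
    then show ?thesis using a b by (simp add: has_coeffs_def)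
  qed
  ultimately have "a n - b n = 0" by (rule fourier_series_eq_0D[OF \<omega>])
  then show "a n = b n" by simp
qed

lemma V_coeff_eq:
  assumes "Z_independent \<omega>" "0 \<le> k" "has_coeffs \<omega> k u a"
  shows "V_coeff \<omega> k u = a"
  unfolding V_coeff_def using has_coeffs_unique[OF assms(1,2)] assms(3) by blast

lemma has_coeffs_cnj:
  assumes "has_coeffs \<omega> k u a"
  shows "has_coeffs \<omega> k (\<lambda>x. cnj (u x)) (\<lambda>n. cnj (a (- n)))"
proof -
  have bij: "bij_betw uminus UNIV (UNIV :: (int ^ 'n) set)"
    by (rule bij_betw_byWitness[of _ uminus]) auto
  have "(\<lambda>n. cmod (cnj (a (- n))) * weight k n) summable_on UNIV"
    using summable_on_reindex_bij_betw[OF bij, of "\<lambda>n. cmod (a n) * weight k n"] assms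
    by (simp add: has_coeffs_def)
  moreover have "cnj (u x) = fourier_series \<omega> (\<lambda>n. cnj (a (- n))) x" for x
  proof -
    have "cnj (u x) = (\<Sum>\<^sub>\<infinity>n. cnj (a n) * wave \<omega> (- n) x)"
      using assms by (simp add: has_coeffs_def fourier_series_wave wave_minus_index flip: infsum_cnj)
    also have "\<dots> = fourier_series \<omega> (\<lambda>n. cnj (a (- n))) x"
      using infsum_reindex_bij_betw[OF bij, of "\<lambda>n. cnj (a n) * wave \<omega> (- n) x"]
      by (simp add: fourier_series_wave)
    finally show ?thesis .
  qed
  ultimately show ?thesis by (auto simp: has_coeffs_def)
qed

text \<open>A function is real-valued iff it equals its conjugate. Conjugation sends the
  coefficients to \<open>cnj (a (- n))\<close>, and uniqueness of coefficients turns equality of the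
  functions into equality of the families.\<close>

lemma has_coeffs_real_iff:
  assumes "Z_independent \<omega>" "0 \<le> k" and u: "has_coeffs \<omega> k u a"
  shows "(\<forall>x. u x \<in> \<real>) \<longleftrightarrow> (\<forall>n. a (- n) = cnj (a n))"
proof
  assume "\<forall>x. u x \<in> \<real>"
  then have "(\<lambda>x. cnj (u x)) = u" by (simp add: fun_eq_iff Reals_cnj_iff)
  with has_coeffs_cnj[OF u] have "has_coeffs \<omega> k u (\<lambda>n. cnj (a (- n)))" by (simp only:)
  then have eq: "a = (\<lambda>n. cnj (a (- n)))" by (rule has_coeffs_unique[OF assms(1,2) u])
  show "\<forall>n. a (- n) = cnj (a n)"
  proof
    fix n
    show "a (- n) = cnj (a n)" using fun_cong[OF eq, of "- n"] by simp
  qed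
next
  assume "\<forall>n. a (- n) = cnj (a n)"
  then have "(\<lambda>n. cnj (a (- n))) = a" by simp
  with has_coeffs_cnj[OF u] have "has_coeffs \<omega> k (\<lambda>x. cnj (u x)) a" by (simp only:)
  then have "(\<lambda>x. cnj (u x)) = u" using u by (simp only: has_coeffs_def)
  then show "\<forall>x. u x \<in> \<real>" by (simp add: fun_eq_iff Reals_cnj_iff)
qed

text \<open>Convolution is used twice: for the weighted moduli, where
  \<open>weight k n \<le> weight k m * weight k (n - m)\<close> lets the weight be split between the
  factors, and for the coefficients times waves, where the phases combine to that of
  \<open>n\<close> and give the pointwise product.\<close>

lemma has_coeffs_mult:
  assumes k: "0 \<le> k" and u: "has_coeffs \<omega> k u a" and v: "has_coeffs \<omega> k v b"
  defines "c \<equiv> \<lambda>n. \<Sum>\<^sub>\<infinity>m. a m * b (n - m)"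
  shows "has_coeffs \<omega> k (\<lambda>x. u x * v x) c"
    and "(\<Sum>\<^sub>\<infinity>n. cmod (c n) * weight k n) \<le>
      (\<Sum>\<^sub>\<infinity>n. cmod (a n) * weight k n) * (\<Sum>\<^sub>\<infinity>n. cmod (b n) * weight k n)"
proof -
  note a = has_coeffs_abs_summable[OF k u] and b = has_coeffs_abs_summable[OF k v]
  let ?A = "\<lambda>n. cmod (a n) * weight k n" and ?B = "\<lambda>n. cmod (b n) * weight k n"
  have A: "?A abs_summable_on UNIV" and B: "?B abs_summable_on UNIV"
    using u v by (auto simp: has_coeffs_def abs_mult less_imp_le)
  note conv = convolution_summable[OF A B]
  have le: "cmod (c n) * weight k n \<le> (\<Sum>\<^sub>\<infinity>m. ?A m * ?B (n - m))" for n
  proof -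
    have ab: "(\<lambda>m. a m * b (n - m)) abs_summable_on UNIV"
      by (rule convolution_summable(1)[OF a b])
    have "cmod (c n) * weight k n \<le> (\<Sum>\<^sub>\<infinity>m. cmod (a m * b (n - m))) * weight k n"
      unfolding c_def using norm_infsum_bound[OF ab] by (intro mult_right_mono) (auto simp: less_imp_le)
    also have "\<dots> = (\<Sum>\<^sub>\<infinity>m. cmod (a m * b (n - m)) * weight k n)"
      using ab by (simp add: infsum_cmult_left)
    also have "\<dots> \<le> (\<Sum>\<^sub>\<infinity>m. ?A m * ?B (n - m))"
    proof (rule infsum_mono)
      show "(\<lambda>m. cmod (a m * b (n - m)) * weight k n) summable_on UNIV"
        using ab by (rule summable_on_cmult_left)
      show "(\<lambda>m. ?A m * ?B (n - m)) summable_on UNIV"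
        using conv(1) by (rule abs_summable_summable)
      show "cmod (a m * b (n - m)) * weight k n \<le> ?A m * ?B (n - m)" for m
      proof -
        have "weight k n \<le> weight k m * weight k (n - m)"
          using weight_add_le[OF k, of m "n - m"] by simp
        then have "cmod (a m * b (n - m)) * weight k n \<le> cmod (a m * b (n - m)) * (weight k m * weight k (n - m))"
          by (rule mult_left_mono) simp
        then show ?thesis by (simp add: norm_mult mult_ac)
      qed
    qed
    finally show ?thesis .
  qed
  have sum: "(\<lambda>n. \<Sum>\<^sub>\<infinity>m. ?A m * ?B (n - m)) summable_on UNIV"
    using conv(2) by (rule abs_summable_summable)
  have c: "(\<lambda>n. cmod (c n) * weight k n) summable_on UNIV"
    by (rule summable_on_comparison_test[OF sum le]) (simp add: less_imp_le)
  show "(\<Sum>\<^sub>\<infinity>n. cmod (c n) * weight k n) \<le> infsum ?A UNIV * infsum ?B UNIV"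
    using infsum_mono[OF c sum le] conv(3) by simp
  have "u x * v x = fourier_series \<omega> c x" for x
  proof -
    have "u x * v x = (\<Sum>\<^sub>\<infinity>n. \<Sum>\<^sub>\<infinity>m. (a m * wave \<omega> m x) * (b (n - m) * wave \<omega> (n - m) x))"
      using convolution_summable(3)[OF abs_summable_wave[OF a] abs_summable_wave[OF b], of \<omega> x \<omega> x] u v
      by (simp add: has_coeffs_def fourier_series_wave)
    also have "\<dots> = (\<Sum>\<^sub>\<infinity>n. \<Sum>\<^sub>\<infinity>m. (a m * b (n - m)) * wave \<omega> n x)"
    proof (intro infsum_cong)
      fix n m
      have "wave \<omega> n x = wave \<omega> m x * wave \<omega> (n - m) x"
        using wave_add_index[of \<omega> m "n - m" x] by simp
      then show "(a m * wave \<omega> m x) * (b (n - m) * wave \<omega> (n - m) x) = (a m * b (n - m)) * wave \<omega> n x"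
        by simp
    qed
    also have "\<dots> = (\<Sum>\<^sub>\<infinity>n. c n * wave \<omega> n x)"
      unfolding c_def by (simp add: infsum_cmult_left')
    finally show ?thesis by (simp add: fourier_series_wave)
  qed
  then show "has_coeffs \<omega> k (\<lambda>x. u x * v x) c"
    using c by (auto simp: has_coeffs_def)
qed

section \<open>The generalized Benjamin--Bona--Mahony equation\<close>

text \<open>The two derivatives in the denominator outweigh the one in the numerator:
  \<open>2 * \<bar>\<xi>\<bar> \<le> 1 + \<xi>\<^sup>2\<close>. So the operator loses no regularity
  and the equation is an ODE in the space itself.\<close>

lemma norm_bbm_symbol_le_1: "cmod (bbm_symbol \<xi>) \<le> 1"
proof -
  have "2 * \<bar>\<xi>\<bar> \<le> 1 + \<xi>\<^sup>2"
    using sum_squares_bound[of 1 "\<bar>\<xi>\<bar>"] by simp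
  moreover have "cmod (1 + (of_real \<xi>)\<^sup>2) = 1 + \<xi>\<^sup>2"
  proof -
    have "(1 + (of_real \<xi>)\<^sup>2 :: complex) = of_real (1 + \<xi>\<^sup>2)" by simp
    then show ?thesis by (simp only: norm_of_real) (simp add: add_nonneg_nonneg)
  qed
  ultimately show ?thesis
    by (simp add: bbm_symbol_def norm_divide norm_mult divide_le_eq add_pos_nonneg)
qed

text \<open>This symmetry makes the multiplier preserve Hermitian families, that is, real-valued
  functions.\<close>

lemma bbm_symbol_minus: "bbm_symbol (- \<xi>) = cnj (bbm_symbol \<xi>)"
  by (simp add: bbm_symbol_def)

lemma has_coeffs_uminus:
  "has_coeffs \<omega> k u a \<Longrightarrow> has_coeffs \<omega> k (\<lambda>x. - u x) (\<lambda>n. - a n)"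
  by (simp add: has_coeffs_def fourier_series_wave fun_eq_iff infsum_uminus)

section \<open>The isometry between Hermitian families and real quasi-periodic functions\<close>

locale quasi_periodic =
  fixes \<omega> :: "real ^ 'n" and k :: real
  assumes indep: "Z_independent \<omega>" and k_pos: "k > 0"
begin

lemma k_nonneg: "0 \<le> k"
  using k_pos by simp

lemmas V_coeff_eq' = V_coeff_eq[OF indep k_nonneg]

text \<open>The identification is taken from families to functions because every family represents a
  function of the space; the inverse \<open>analysis\<close> is meaningful only on
  \<open>VR_space \<omega> k\<close>.\<close>

definition synth :: "'n herm_l1 \<Rightarrow> real \<Rightarrow> complex" where
  "synth b = fourier_series \<omega> (\<lambda>n. coeff b n / of_real (weight k n))"

lemma has_coeffs_synth: "has_coeffs \<omega> k (synth b) (\<lambda>n. coeff b n / of_real (weight k n))"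
  using coeff_summable[of b] by (simp add: has_coeffs_def synth_def norm_divide less_imp_le)

lemma V_coeff_synth: "V_coeff \<omega> k (synth b) = (\<lambda>n. coeff b n / of_real (weight k n))"
  by (rule V_coeff_eq'[OF has_coeffs_synth])

lemma V_norm_synth: "V_norm \<omega> k (synth b) = norm b"
  by (simp add: V_norm_def V_coeff_synth norm_herm_l1_def norm_divide less_imp_le)

lemma synth_in_VR: "synth b \<in> VR_space \<omega> k"
  using has_coeffs_real_iff[OF indep k_nonneg has_coeffs_synth[of b]] has_coeffs_synth[of b]
  by (auto simp: VR_space_def V_space_def coeff_minus_index)

lemma synth_surj:
  assumes "u \<in> VR_space \<omega> k"
  obtains b where "u = synth b"
proof -
  obtain a where a: "has_coeffs \<omega> k u a" and real: "\<forall>x. u x \<in> \<real>"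
    using assms by (auto simp: VR_space_def V_space_def)
  then have sym: "a (- n) = cnj (a n)" for n
    using has_coeffs_real_iff[OF indep k_nonneg a] by blast
  have "coeff (Herm_l1 (\<lambda>n. a n * of_real (weight k n))) = (\<lambda>n. a n * of_real (weight k n))"
    using a by (intro coeff_Herm_l1) (auto simp: has_coeffs_def norm_mult less_imp_le sym)
  then have "synth (Herm_l1 (\<lambda>n. a n * of_real (weight k n))) = u"
    using a by (simp add: synth_def has_coeffs_def)
  then show thesis using that by blast
qed

lemma summable_synth: "(\<lambda>n. coeff b n / of_real (weight k n) * wave \<omega> n x) summable_on UNIV"
  by (rule summable_wave[OF has_coeffs_abs_summable[OF k_nonneg has_coeffs_synth]])

lemma synth_add: "synth (b + c) x = synth b x + synth c x"
  using infsum_add[OF summable_synth[of b x] summable_synth[of c x]]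
  by (simp add: synth_def fourier_series_wave add_divide_distrib distrib_right)

lemma synth_scaleR: "synth (r *\<^sub>R b) x = of_real r * synth b x"
  unfolding synth_def fourier_series_wave
  by (subst infsum_cmult_right'[symmetric]) (simp add: scaleR_conv_of_real mult.assoc)

lemma synth_uminus: "synth (- b) x = - synth b x"
  using synth_scaleR[of "-1" b x] by simp

lemma synth_diff: "synth (b - c) x = synth b x - synth c x"
  using synth_add[of b "- c" x] by (simp add: synth_uminus)

lemma V_norm_synth_diff: "V_norm \<omega> k (\<lambda>x. synth b x - synth c x) = dist b c"
  using V_norm_synth[of "b - c"] by (simp add: dist_norm synth_diff[abs_def])

lemma synth_inject: "synth b = synth c \<longleftrightarrow> b = c"
proof
  assume "synth b = synth c"
  then have "dist b c = dist b b" by (simp only: V_norm_synth_diff[symmetric])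
  then show "b = c" by simp
qed simp

definition analysis :: "(real \<Rightarrow> complex) \<Rightarrow> 'n herm_l1" where
  "analysis = inv synth"

lemma analysis_synth [simp]: "analysis (synth b) = b"
  unfolding analysis_def by (rule inv_f_f) (simp add: inj_def synth_inject)

lemma synth_analysis: "u \<in> VR_space \<omega> k \<Longrightarrow> synth (analysis u) = u"
  by (metis analysis_synth synth_surj)

section \<open>Product, powers and multiplier on Hermitian families\<close>

definition herm_mult :: "'n herm_l1 \<Rightarrow> 'n herm_l1 \<Rightarrow> 'n herm_l1" where
  "herm_mult b c = analysis (\<lambda>x. synth b x * synth c x)"

lemma synth_herm_mult: "synth (herm_mult b c) x = synth b x * synth c x"
proof -
  have "(\<lambda>x. synth b x * synth c x) \<in> VR_space \<omega> k"
    using has_coeffs_mult(1)[OF k_nonneg has_coeffs_synth[of b] has_coeffs_synth[of c]]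
      synth_in_VR[of b] synth_in_VR[of c]
    unfolding VR_space_def V_space_def by (blast intro: Reals_mult)
  from synth_analysis[OF this] show ?thesis by (simp add: herm_mult_def)
qed

lemma norm_herm_mult_le: "norm (herm_mult b c) \<le> norm b * norm c"
proof -
  note m = has_coeffs_mult[OF k_nonneg has_coeffs_synth[of b] has_coeffs_synth[of c]]
  have "synth (herm_mult b c) = (\<lambda>x. synth b x * synth c x)"
    by (simp add: fun_eq_iff synth_herm_mult)
  then have "norm (herm_mult b c) = V_norm \<omega> k (\<lambda>x. synth b x * synth c x)"
    by (metis V_norm_synth)
  also have "\<dots> \<le> V_norm \<omega> k (synth b) * V_norm \<omega> k (synth c)"
    unfolding V_norm_def V_coeff_eq'[OF m(1)] V_coeff_synth by (rule m(2))
  finally show ?thesis by (simp add: V_norm_synth)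
qed

text \<open>The product is transported from functions rather than written as a convolution. As
  \<open>synth\<close> is injective, each law reduces to an identity between complex numbers at
  every \<open>x\<close>.\<close>

lemma bounded_bilinear_herm_mult: "bounded_bilinear herm_mult"
proof
  show "herm_mult (b + b') c = herm_mult b c + herm_mult b' c"
    and "herm_mult c (b + b') = herm_mult c b + herm_mult c b'"
    and "herm_mult (r *\<^sub>R b) c = r *\<^sub>R herm_mult b c"
    and "herm_mult b (r *\<^sub>R c) = r *\<^sub>R herm_mult b c" for b b' c r
    unfolding synth_inject[symmetric] fun_eq_iff
    by (simp_all add: synth_herm_mult synth_add synth_scaleR distrib_left distrib_right)
  show "\<exists>K. \<forall>b c. norm (herm_mult b c) \<le> norm b * norm c * K"
    by (intro exI[of _ 1]) (simp add: norm_herm_mult_le)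
qed

text \<open>Starting at the first power avoids introducing a unit. The index is therefore one less
  than the exponent, and index \<open>p\<close> is the power \<open>p + 1\<close> of the
  equation.\<close>

primrec herm_power_Suc :: "'n herm_l1 \<Rightarrow> nat \<Rightarrow> 'n herm_l1" where
  "herm_power_Suc b 0 = b"
| "herm_power_Suc b (Suc j) = herm_mult b (herm_power_Suc b j)"

lemma synth_herm_power_Suc: "synth (herm_power_Suc b j) x = synth b x ^ (j + 1)"
  by (induction j) (simp_all add: synth_herm_mult)

text \<open>A diagonal operator commutes with multiplication by the weight, so the same symbol acts
  on weighted and unweighted coefficients. \<open>coeff_bbm_multiplier\<close> verifies that the
  family is admissible for \<open>Herm_l1\<close>.\<close>

definition bbm_multiplier :: "'n herm_l1 \<Rightarrow> 'n herm_l1" where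
  "bbm_multiplier b = Herm_l1 (\<lambda>n. bbm_symbol (freq \<omega> n) * coeff b n)"

lemma norm_bbm_coeff_le: "cmod (bbm_symbol (freq \<omega> n) * coeff b n) \<le> cmod (coeff b n)"
  using mult_right_mono[OF norm_bbm_symbol_le_1, of "cmod (coeff b n)" "freq \<omega> n"] by (simp add: norm_mult)

lemma coeff_bbm_multiplier: "coeff (bbm_multiplier b) n = bbm_symbol (freq \<omega> n) * coeff b n"
proof -
  have "(\<lambda>n. cmod (bbm_symbol (freq \<omega> n) * coeff b n)) summable_on UNIV"
    by (rule summable_on_comparison_test[OF coeff_summable norm_bbm_coeff_le]) simp
  then show ?thesis
    unfolding bbm_multiplier_def
    by (subst coeff_Herm_l1) (auto simp: freq_minus bbm_symbol_minus coeff_minus_index)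
qed

lemma bounded_linear_bbm_multiplier: "bounded_linear bbm_multiplier"
proof (rule bounded_linear_intro[of _ 1])
  show "norm (bbm_multiplier b) \<le> norm b * 1" for b
    unfolding norm_herm_l1_def mult_1_right
    by (rule infsum_mono[OF coeff_summable coeff_summable])
      (simp only: coeff_bbm_multiplier norm_bbm_coeff_le)
qed (auto intro!: herm_l1_eqI simp: coeff_bbm_multiplier distrib_left)

definition gbbm_field :: "nat \<Rightarrow> 'n herm_l1 \<Rightarrow> 'n herm_l1" where
  "gbbm_field p b = bbm_multiplier (b + herm_power_Suc b p)"

lemma locally_lipschitz_gbbm_field: "locally_lipschitz (gbbm_field p)"
proof -
  have "locally_lipschitz (\<lambda>b. herm_power_Suc b j)" for j
    by (induction j)
      (simp_all add: locally_lipschitz_id locally_lipschitz_bilinear[OF bounded_bilinear_herm_mult])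
  then show ?thesis
    unfolding gbbm_field_def
    by (intro locally_lipschitz_linear[OF bounded_linear_bbm_multiplier] locally_lipschitz_add
        locally_lipschitz_id)
qed

lemma synth_gbbm_field:
  "synth (gbbm_field p b) =
    fourier_multiplier \<omega> k bbm_symbol (\<lambda>x. synth b x + synth b x ^ (p + 1))"
proof -
  have "(\<lambda>x. synth b x + synth b x ^ (p + 1)) = synth (b + herm_power_Suc b p)"
    by (simp add: fun_eq_iff synth_add synth_herm_power_Suc)
  then show ?thesis
    by (simp only: fourier_multiplier_def V_coeff_synth)
      (simp add: synth_def gbbm_field_def coeff_bbm_multiplier)
qed

section \<open>Transfer of limits, derivatives and solutions to the metric space\<close>

lemma Metric_space_VR: "Metric_space (VR_space \<omega> k) (\<lambda>u v. V_norm \<omega> k (\<lambda>x. u x - v x))"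
proof
  show "0 \<le> V_norm \<omega> k (\<lambda>x. u x - v x)" for u v
    unfolding V_norm_def by (rule infsum_nonneg) (simp add: less_imp_le)
  have "V_norm \<omega> k (\<lambda>x. - w x) = V_norm \<omega> k w" for w
  proof (cases "\<exists>a. has_coeffs \<omega> k w a")
    case True
    then obtain a where a: "has_coeffs \<omega> k w a" by blast
    show ?thesis
      by (simp add: V_norm_def V_coeff_eq'[OF a] V_coeff_eq'[OF has_coeffs_uminus[OF a]])
  next
    \<comment> \<open>Symmetry is demanded for all functions, also outside the carrier. Here neither
      \<open>w\<close> nor its negative has coefficients, so both values of \<open>V_coeff\<close>
      come from the description operator applied to the same empty predicate.\<close>
    case False
    then have "\<not> has_coeffs \<omega> k (\<lambda>x. - w x) a" for a
      using has_coeffs_uminus[of \<omega> k "\<lambda>x. - w x" a] by auto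
    then have "has_coeffs \<omega> k (\<lambda>x. - w x) = has_coeffs \<omega> k w"
      using False by auto
    then show ?thesis by (simp add: V_norm_def V_coeff_def)
  qed
  from this[of "\<lambda>x. u x - v x" for u v]
  show "V_norm \<omega> k (\<lambda>x. u x - v x) = V_norm \<omega> k (\<lambda>x. v x - u x)" for u v
    by (simp add: minus_diff_eq)
next
  fix u v assume "u \<in> VR_space \<omega> k" "v \<in> VR_space \<omega> k"
  then obtain b c where uv: "u = synth b" "v = synth c" by (metis synth_surj)
  show "V_norm \<omega> k (\<lambda>x. u x - v x) = 0 \<longleftrightarrow> u = v"
    unfolding uv V_norm_synth_diff synth_inject by simp
  fix w assume "w \<in> VR_space \<omega> k"
  then obtain d where w: "w = synth d" by (metis synth_surj)
  show "V_norm \<omega> k (\<lambda>x. u x - w x) \<le> V_norm \<omega> k (\<lambda>x. u x - v x) + V_norm \<omega> k (\<lambda>x. v x - w x)"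
    unfolding uv w V_norm_synth_diff by (rule dist_triangle)
qed

sublocale VR: Metric_space "VR_space \<omega> k" "\<lambda>u v. V_norm \<omega> k (\<lambda>x. u x - v x)"
  by (rule Metric_space_VR)

lemma mspace_VR [simp]: "mspace (VR_metric \<omega> k) = VR_space \<omega> k"
  and mdist_VR: "mdist (VR_metric \<omega> k) u v = V_norm \<omega> k (\<lambda>x. u x - v x)"
  and mtopology_VR: "mtopology_of (VR_metric \<omega> k) = VR.mtopology"
  by (simp_all add: VR_metric_def mtopology_of_def)

lemma mdist_synth: "mdist (VR_metric \<omega> k) (synth b) (synth c) = dist b c"
  by (simp add: mdist_VR V_norm_synth_diff)

lemma synth_in_mball: "synth b \<in> mball_of (VR_metric \<omega> k) (synth c) r \<longleftrightarrow> b \<in> ball c r"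
  by (simp add: VR_metric_def mball_of_def V_norm_synth_diff synth_in_VR)

lemma limitin_synth:
  "limitin (mtopology_of (VR_metric \<omega> k)) (\<lambda>s. synth (g s)) (synth l) F \<longleftrightarrow> (g \<longlongrightarrow> l) F"
  unfolding mtopology_VR VR.limitin_metric tendsto_iff by (simp add: synth_in_VR V_norm_synth_diff)

lemma continuous_map_synth:
  assumes "continuous_on S g"
  shows "continuous_map (top_of_set S) (mtopology_of (VR_metric \<omega> k)) (\<lambda>t. synth (g t))"
  unfolding continuous_map_atin
proof
  fix t assume "t \<in> topspace (top_of_set S)"
  then have "t \<in> S" by simp
  then have "(g \<longlongrightarrow> g t) (at t within S)"
    using assms by (simp add: continuous_on_def)
  then show "limitin (mtopology_of (VR_metric \<omega> k)) (\<lambda>t. synth (g t)) (synth (g t)) (atin (top_of_set S) t)"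
    using \<open>t \<in> S\<close> by (simp add: limitin_synth atin_top_of_set)
qed

text \<open>\<open>u\<close> is compared with \<open>synth (w s)\<close> on \<open>S\<close> only,
  because solutions are undefined elsewhere. That suffices: apart from the fixed value at
  \<open>t\<close>, the limit sees only quotients with \<open>s\<close> in \<open>S\<close>.\<close>

lemma has_VR_derivative_synth:
  assumes u: "\<And>s. s \<in> S \<Longrightarrow> u s = synth (w s)" and t: "t \<in> S"
  shows "has_VR_derivative \<omega> k u (synth v) t S \<longleftrightarrow> (w has_vector_derivative v) (at t within S)"
proof -
  have ev: "\<forall>\<^sub>F s in at t within S. (\<lambda>x. (u s x - u t x) / of_real (s - t)) = synth ((w s - w t) /\<^sub>R (s - t))"
    unfolding eventually_at_filter using u t
    by (intro always_eventually) (auto simp: fun_eq_iff synth_diff synth_scaleR divide_inverse mult.commute)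
  have ev': "\<forall>\<^sub>F s in at t within S. synth ((w s - w t) /\<^sub>R (s - t)) = (\<lambda>x. (u s x - u t x) / of_real (s - t))"
    by (rule eventually_mono[OF ev]) (rule sym)
  have "has_VR_derivative \<omega> k u (synth v) t S \<longleftrightarrow>
      limitin (mtopology_of (VR_metric \<omega> k)) (\<lambda>s. synth ((w s - w t) /\<^sub>R (s - t))) (synth v) (at t within S)"
    unfolding has_VR_derivative_def
    by (intro iffI) (erule limitin_transform_eventually[OF ev], erule limitin_transform_eventually[OF ev'])
  then show ?thesis
    by (simp add: limitin_synth has_vector_derivative_iff_quotient)
qed

text \<open>The dictionary between the equation and the abstract ODE. Values of \<open>w\<close>
  outside the interval are arbitrary and \<open>restrict\<close> removes them. Conversely, the
  continuous \<open>u'\<close> required of a solution is obtained from continuity of the field along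
  \<open>w\<close>.\<close>

lemma gbbm_solution_iff:
  assumes T: "T > 0"
  shows "gbbm_solution \<omega> k p T f u \<longleftrightarrow>
    (\<exists>w. u = restrict (\<lambda>t. synth (w t)) {-T..T} \<and> solves_ode_on (gbbm_field p) {-T..T} w \<and> synth (w 0) = f)"
proof
  assume sol: "gbbm_solution \<omega> k p T f u"
  define w where "w = (\<lambda>t. analysis (u t))"
  have uw: "u t = synth (w t)" if "t \<in> {-T..T}" for t
  proof -
    have "u t \<in> VR_space \<omega> k" using sol that unfolding gbbm_solution_def by blast
    then show ?thesis by (simp add: w_def synth_analysis)
  qed
  have "solves_ode_on (gbbm_field p) {-T..T} w"
    unfolding solves_ode_on_def
  proof
    fix t assume t: "t \<in> {-T..T}"
    obtain u' where u': "has_VR_derivative \<omega> k u (u' t) t {-T..T}"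
        "u' t = fourier_multiplier \<omega> k bbm_symbol (\<lambda>x. u t x + u t x ^ (p + 1))"
      using sol t unfolding gbbm_solution_def by blast
    then have "has_VR_derivative \<omega> k u (synth (gbbm_field p (w t))) t {-T..T}"
      unfolding synth_gbbm_field uw[OF t] by simp
    then show "(w has_vector_derivative gbbm_field p (w t)) (at t within {-T..T})"
      using has_VR_derivative_synth[of "{-T..T}" u w t] uw t by simp
  qed
  moreover have "u = restrict (\<lambda>t. synth (w t)) {-T..T}"
  proof
    fix t
    show "u t = restrict (\<lambda>t. synth (w t)) {-T..T} t"
      using sol uw[of t] PiE_arb[of u "{-T..T}" "\<lambda>_. VR_space \<omega> k" t]
      by (cases "t \<in> {-T..T}") (simp_all add: gbbm_solution_def restrict_def)
  qed
  moreover have "synth (w 0) = f"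
    using sol uw[of 0] T by (simp add: gbbm_solution_def)
  ultimately show "\<exists>w. u = restrict (\<lambda>t. synth (w t)) {-T..T} \<and>
      solves_ode_on (gbbm_field p) {-T..T} w \<and> synth (w 0) = f" by blast
next
  assume "\<exists>w. u = restrict (\<lambda>t. synth (w t)) {-T..T} \<and> solves_ode_on (gbbm_field p) {-T..T} w \<and> synth (w 0) = f"
  then obtain w where u: "u = restrict (\<lambda>t. synth (w t)) {-T..T}"
    and w: "solves_ode_on (gbbm_field p) {-T..T} w" "synth (w 0) = f" by blast
  have "continuous_on UNIV (gbbm_field p)"
    by (rule locally_lipschitz_continuous[OF locally_lipschitz_gbbm_field])
  then have "continuous_on {-T..T} (\<lambda>t. gbbm_field p (w t))"
    using solves_ode_on_continuous[OF w(1)] by (rule continuous_on_compose2) simp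
  moreover have "has_VR_derivative \<omega> k u (synth (gbbm_field p (w t))) t {-T..T}" if "t \<in> {-T..T}" for t
    using has_VR_derivative_synth[of "{-T..T}" u w t] w(1) that by (simp add: u solves_ode_on_def)
  moreover have "synth (gbbm_field p (w t)) = fourier_multiplier \<omega> k bbm_symbol (\<lambda>x. u t x + u t x ^ (p + 1))"
    if "t \<in> {-T..T}" for t
    using that by (simp add: u synth_gbbm_field)
  ultimately show "gbbm_solution \<omega> k p T f u"
    unfolding gbbm_solution_def using w(2) T
    by (intro conjI exI[of _ "\<lambda>t. synth (gbbm_field p (w t))"] continuous_map_synth)
      (auto simp: u synth_in_VR)
qed

lemma gbbm_solution_unique:
  assumes "T > 0" "gbbm_solution \<omega> k p T f u" "gbbm_solution \<omega> k p T f v"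
  shows "u = v"
proof -
  obtain y z where y: "u = restrict (\<lambda>t. synth (y t)) {-T..T}"
      "solves_ode_on (gbbm_field p) {-T..T} y" "synth (y 0) = f"
    and z: "v = restrict (\<lambda>t. synth (z t)) {-T..T}"
      "solves_ode_on (gbbm_field p) {-T..T} z" "synth (z 0) = f"
    using assms unfolding gbbm_solution_iff[OF assms(1)] by blast
  have "y 0 = z 0" using y(3) z(3) synth_inject by metis
  then have "y t = z t" if "t \<in> {-T..T}" for t
    using ode_unique[OF locally_lipschitz_gbbm_field y(2) z(2) _ that] by simp
  then show ?thesis unfolding y(1) z(1) by (auto simp: fun_eq_iff restrict_def)
qed

text \<open>Since \<open>synth\<close> is an isometry, the ball, the time and the Lipschitz constant
  2 of the abstract theorem carry over unchanged; the estimate at each time becomes one for the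
  supremum over the interval.\<close>

theorem gbbm_locally_well_posed:
  assumes u0: "u0 \<in> VR_space \<omega> k"
  shows "\<exists>r T. r > 0 \<and> T > 0 \<and>
    (\<forall>f \<in> mball_of (VR_metric \<omega> k) u0 r. \<exists>!u. gbbm_solution \<omega> k p T f u) \<and>
    Lipschitz_continuous_map
      (submetric (VR_metric \<omega> k) (mball_of (VR_metric \<omega> k) u0 r))
      (cfunspace (top_of_set {-T..T}) (VR_metric \<omega> k))
      (gbbm_flow \<omega> k p T)"
proof -
  obtain b0 where b0: "u0 = synth b0" using synth_surj[OF u0] .
  obtain r T where r: "r > 0" and T: "T > 0"
    and ex: "\<And>b. b \<in> ball b0 r \<Longrightarrow> \<exists>w. solves_ode_on (gbbm_field p) {-T..T} w \<and> w 0 = b"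
    and dep: "\<And>w z t. solves_ode_on (gbbm_field p) {-T..T} w \<Longrightarrow> solves_ode_on (gbbm_field p) {-T..T} z \<Longrightarrow>
      w 0 \<in> ball b0 r \<Longrightarrow> z 0 \<in> ball b0 r \<Longrightarrow> t \<in> {-T..T} \<Longrightarrow> dist (w t) (z t) \<le> 2 * dist (w 0) (z 0)"
    using ode_locally_well_posed[OF locally_lipschitz_gbbm_field, of b0 p] by blast
  let ?B = "mball_of (VR_metric \<omega> k) u0 r"
  let ?C = "cfunspace (top_of_set {-T..T}) (VR_metric \<omega> k)"
  have in_B: "\<exists>b. f = synth b \<and> b \<in> ball b0 r" if "f \<in> ?B" for f
  proof -
    have "f \<in> VR_space \<omega> k" using that by (simp add: VR_metric_def mball_of_def)
    then obtain b where "f = synth b" by (rule synth_surj)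
    then show ?thesis using that synth_in_mball b0 by blast
  qed
  have ex1: "\<exists>!u. gbbm_solution \<omega> k p T f u" if f: "f \<in> ?B" for f
  proof -
    obtain b where b: "f = synth b" "b \<in> ball b0 r" using in_B[OF f] by blast
    obtain w where "solves_ode_on (gbbm_field p) {-T..T} w" "w 0 = b" using ex[OF b(2)] by blast
    then have "gbbm_solution \<omega> k p T f (restrict (\<lambda>t. synth (w t)) {-T..T})"
      unfolding gbbm_solution_iff[OF T] b(1) by blast
    then show ?thesis using gbbm_solution_unique[OF T] by blast
  qed
  have flow: "\<exists>w. gbbm_flow \<omega> k p T f = restrict (\<lambda>t. synth (w t)) {-T..T} \<and>
      solves_ode_on (gbbm_field p) {-T..T} w \<and> synth (w 0) = f \<and> w 0 \<in> ball b0 r" if f: "f \<in> ?B" for f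
  proof -
    have "gbbm_solution \<omega> k p T f (gbbm_flow \<omega> k p T f)"
      unfolding gbbm_flow_def by (rule theI'[OF ex1[OF f]])
    then obtain w where w: "gbbm_flow \<omega> k p T f = restrict (\<lambda>t. synth (w t)) {-T..T}"
        "solves_ode_on (gbbm_field p) {-T..T} w" "synth (w 0) = f"
      unfolding gbbm_solution_iff[OF T] by blast
    moreover have "w 0 \<in> ball b0 r"
      using f w(3) b0 synth_in_mball by blast
    ultimately show ?thesis by blast
  qed
  \<comment> \<open>Membership in the function space also asks for a bounded image, which
    compactness of the time interval supplies.\<close>
  have in_C: "restrict (\<lambda>t. synth (w t)) {-T..T} \<in> mspace ?C"
    if w: "solves_ode_on (gbbm_field p) {-T..T} w" for w
  proof -
    have cont: "continuous_map (top_of_set {-T..T}) (mtopology_of (VR_metric \<omega> k))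
        (restrict (\<lambda>t. synth (w t)) {-T..T})"
      by (rule continuous_map_eq[OF continuous_map_synth[OF solves_ode_on_continuous[OF w]]]) simp
    have "compactin (top_of_set {-T..T}) {-T..T}"
      by (simp add: compactin_subtopology)
    then have "VR.mbounded (restrict (\<lambda>t. synth (w t)) {-T..T} ` {-T..T})"
      using image_compactin[OF _ cont] VR.compactin_imp_mbounded by (simp only: mtopology_VR)
    then show ?thesis
      using cont by (simp add: VR_metric_def synth_in_VR)
  qed
  have "mdist ?C (gbbm_flow \<omega> k p T f) (gbbm_flow \<omega> k p T g) \<le> 2 * mdist (VR_metric \<omega> k) f g"
    if fg: "f \<in> ?B" "g \<in> ?B" for f g
  proof -
    obtain y z where y: "gbbm_flow \<omega> k p T f = restrict (\<lambda>t. synth (y t)) {-T..T}"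
        "solves_ode_on (gbbm_field p) {-T..T} y" "synth (y 0) = f" "y 0 \<in> ball b0 r"
      and z: "gbbm_flow \<omega> k p T g = restrict (\<lambda>t. synth (z t)) {-T..T}"
        "solves_ode_on (gbbm_field p) {-T..T} z" "synth (z 0) = g" "z 0 \<in> ball b0 r"
      using flow[OF fg(1)] flow[OF fg(2)] by blast
    have fg: "mdist (VR_metric \<omega> k) f g = dist (y 0) (z 0)"
      unfolding y(3)[symmetric] z(3)[symmetric] by (rule mdist_synth)
    show ?thesis
    proof (rule mdist_cfunspace_le)
      fix t assume "t \<in> topspace (top_of_set {-T..T})"
      then have t: "t \<in> {-T..T}" by simp
      have "dist (y t) (z t) \<le> 2 * dist (y 0) (z 0)"
        using dep y(2,4) z(2,4) t by blast
      then show "mdist (VR_metric \<omega> k) (gbbm_flow \<omega> k p T f t) (gbbm_flow \<omega> k p T g t) \<le>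
          2 * mdist (VR_metric \<omega> k) f g"
        using t by (simp add: y(1) z(1) mdist_synth fg)
    qed (simp add: fg)
  qed
  moreover have "gbbm_flow \<omega> k p T f \<in> mspace ?C" if "f \<in> ?B" for f
    using flow[OF that] in_C by metis
  ultimately have "Lipschitz_continuous_map (submetric (VR_metric \<omega> k) ?B) ?C (gbbm_flow \<omega> k p T)"
    unfolding Lipschitz_continuous_map_def by (auto intro!: exI[of _ 2] simp del: mspace_cfunspace)
  then show ?thesis using r T ex1 by blast
qed

end

theorem mainTheorem4:
  fixes \<omega> :: "real ^ 'n" and k :: real and p :: nat
  assumes "p \<ge> 1" and "Z_independent \<omega>" and "k > 0"
  shows "\<forall>u0 \<in> VR_space \<omega> k.
           \<exists>c r T. c \<in> VR_space \<omega> k \<and> r > 0 \<and> T > 0 \<and>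
             u0 \<in> mball_of (VR_metric \<omega> k) c r \<and>
             (\<forall>f \<in> mball_of (VR_metric \<omega> k) c r. \<exists>!u. gbbm_solution \<omega> k p T f u) \<and>
             Lipschitz_continuous_map
               (submetric (VR_metric \<omega> k) (mball_of (VR_metric \<omega> k) c r))
               (cfunspace (top_of_set {-T..T}) (VR_metric \<omega> k))
               (gbbm_flow \<omega> k p T)"
proof
  fix u0 assume u0: "u0 \<in> VR_space \<omega> k"
  interpret quasi_periodic \<omega> k
    using assms(2,3) by unfold_locales
  obtain r T where rT: "r > 0" "T > 0"
      "\<forall>f \<in> mball_of (VR_metric \<omega> k) u0 r. \<exists>!u. gbbm_solution \<omega> k p T f u"
      "Lipschitz_continuous_map (submetric (VR_metric \<omega> k) (mball_of (VR_metric \<omega> k) u0 r))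
        (cfunspace (top_of_set {-T..T}) (VR_metric \<omega> k)) (gbbm_flow \<omega> k p T)"
    using gbbm_locally_well_posed[OF u0] by blast
  \<comment> \<open>The centre of the ball may be chosen freely; \<open>u0\<close> itself is
    taken.\<close>
  have "u0 \<in> mball_of (VR_metric \<omega> k) u0 r"
    using synth_surj[OF u0] synth_in_mball rT(1) centre_in_ball by metis
  then show "\<exists>c r T. c \<in> VR_space \<omega> k \<and> r > 0 \<and> T > 0 \<and>
      u0 \<in> mball_of (VR_metric \<omega> k) c r \<and>
      (\<forall>f \<in> mball_of (VR_metric \<omega> k) c r. \<exists>!u. gbbm_solution \<omega> k p T f u) \<and>
      Lipschitz_continuous_map
        (submetric (VR_metric \<omega> k) (mball_of (VR_metric \<omega> k) c r))
        (cfunspace (top_of_set {-T..T}) (VR_metric \<omega> k))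
        (gbbm_flow \<omega> k p T)"
    using u0 rT by blast
qed

end
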